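(* There is a function $\varepsilon:\mathbb{N}\to\mathbb{R}$ with $\varepsilon(d)\to 0$ as $d\to\infty$ such that for every integer $g\ge 3$ and every positive integer $d$ there exists a finite orthogonality graph $G$ in $\mathbb{S}^{d-1}$ with girth at least $g$ and $\chi(G)\ge (1.074+\varepsilon(d))^d$.
   Context: $\mathbb{S}^{d-1}\subseteq\mathbb{R}^d$ is the set of unit vectors. A graph $G$ is an orthogonality graph in a set $S\subseteq\mathbb{R}^d$ if there is an injective map from $V(G)$ to $S$ such that any two adjacent vertices are mapped to orthogonal vectors (non-adjacent vertices may also be mapped to orthogonal vectors). The girth of a graph is the length of its shortest cycle. $\chi(G)$ denotes the chromatic number. *)

theory Defs
  imports Complex_Main
begin

definition simple_graph :: "nat set \<Rightarrow> (nat \<times> nat) set \<Rightarrow> bool" where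
  "simple_graph V E \<longleftrightarrow> E \<subseteq> V \<times> V \<and> (\<forall>u v. (u, v) \<in> E \<longrightarrow> (v, u) \<in> E)
     \<and> (\<forall>v. (v, v) \<notin> E)"

text \<open>Vectors of R^d are functions nat \<Rightarrow> real vanishing at coordinates \<ge> d.\<close>

definition inner_d :: "nat \<Rightarrow> (nat \<Rightarrow> real) \<Rightarrow> (nat \<Rightarrow> real) \<Rightarrow> real" where
  "inner_d d x y = (\<Sum>i<d. x i * y i)"

definition unit_sphere :: "nat \<Rightarrow> (nat \<Rightarrow> real) set" where
  "unit_sphere d = {x. (\<forall>i\<ge>d. x i = 0) \<and> inner_d d x x = 1}"

definition orthogonality_graph_in ::
  "nat \<Rightarrow> (nat \<Rightarrow> real) set \<Rightarrow> nat set \<Rightarrow> (nat \<times> nat) set \<Rightarrow> bool" where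
  "orthogonality_graph_in d S V E \<longleftrightarrow>
     (\<exists>f. inj_on f V \<and> f ` V \<subseteq> S \<and> (\<forall>(u, v)\<in>E. inner_d d (f u) (f v) = 0))"

definition is_cycle :: "nat set \<Rightarrow> (nat \<times> nat) set \<Rightarrow> nat list \<Rightarrow> bool" where
  "is_cycle V E xs \<longleftrightarrow> length xs \<ge> 3 \<and> distinct xs \<and> set xs \<subseteq> V \<and>
     (\<forall>i<length xs. (xs ! i, xs ! ((i + 1) mod length xs)) \<in> E)"

text \<open>Girth at least g: every cycle has length at least g (acyclic graphs have infinite girth).\<close>

definition girth_at_least :: "nat \<Rightarrow> nat set \<Rightarrow> (nat \<times> nat) set \<Rightarrow> bool" where
  "girth_at_least g V E \<longleftrightarrow> (\<forall>xs. is_cycle V E xs \<longrightarrow> length xs \<ge> g)"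

definition proper_colouring :: "nat set \<Rightarrow> (nat \<times> nat) set \<Rightarrow> (nat \<Rightarrow> nat) \<Rightarrow> nat \<Rightarrow> bool" where
  "proper_colouring V E c k \<longleftrightarrow> c ` V \<subseteq> {..<k} \<and> (\<forall>(u, v)\<in>E. c u \<noteq> c v)"

definition chromatic_number :: "nat set \<Rightarrow> (nat \<times> nat) set \<Rightarrow> nat" where
  "chromatic_number V E = (LEAST k. \<exists>c. proper_colouring V E c k)"

end

theory Submission
  imports Defs "HOL-Library.FuncSet" "HOL-Computational_Algebra.Primes" "HOL-Real_Asymp.Real_Asymp"
begin

text \<open>
  Split \<open>2 * t\<close> of the coordinates into \<open>t\<close> planes and consider the words over the alphabet
  \<open>0, \<plusminus>e\<^sub>1, \<plusminus>e\<^sub>2\<close> with exactly \<open>p\<close> nonzero letters, \<open>p\<close> an odd prime. By the polynomial method modulo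
  \<open>p\<close> (Frankl and Wilson) a set of words without orthogonal pairs is exponentially small, even if
  only pairs with different supports are considered: a parity argument excludes the others.

  Rotating the \<open>t\<close> planes independently produces arbitrarily many copies of this graph. Words with
  different supports have different stabilisers in the torus of rotations, so fixing one endpoint of
  an edge leaves many positions for the other one. The union of the copies is therefore locally
  rich enough for a greedy choice of edges that keeps the girth large and destroys all colourings
  with few colours.

  The rate per plane exceeds \<open>1.074\<^sup>2\<close> for all \<open>p\<close> between \<open>0.31 * t\<close> and \<open>0.7 * t\<close>. As this ratio is larger
  than 2, Chebyshev's bounds provide such a prime.
\<close>

section \<open>Primes in a multiplicative interval\<close>

text \<open>In a fixed dimension one copy of the word graph has bounded size, so large girth needs
  many copies, and these must share vertices: disjoint copies would keep all degrees bounded and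
  leave no freedom to avoid short cycles. With \<open>m\<close> angles per plane there are
  \<open>m ^ t\<close> copies, each with a monochromatic edge under every colouring. A word is
  determined by the angles on its support and so has about \<open>m ^ p\<close> positions; a vertex
  lies in about \<open>m ^ (t - p)\<close> copies. An edge between different supports fixes at least
  \<open>p + 1\<close> angles, so it lies in at most about \<open>m ^ (t - p - 1)\<close> copies. If
  the chosen edges keep the maximum degree independent of \<open>m\<close>, only
  \<open>O(m ^ p)\<close> pairs are at bounded distance, and they block
  \<open>O(m ^ (t - 1))\<close> candidates, a vanishing share of \<open>m ^ t\<close>. Edges with
  equal supports would lose exactly this factor \<open>m\<close>.

  The prime is both the modulus and the squared norm of a word. This ties the weight of the words to
  a prime, and hence the exponential rate to the position of a prime relative to
  \<open>t\<close>.\<close>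

lemma prod_primes_dvd:
  fixes A :: "nat set" and n :: nat
  assumes "finite A" and "\<And>q. q \<in> A \<Longrightarrow> prime q \<and> q dvd n"
  shows "\<Prod>A dvd n"
  using assms
proof (induction A rule: finite_induct)
  case (insert q A)
  have "coprime q (\<Prod>A)"
    using insert by (intro prod_coprime_right) (auto intro: primes_coprime)
  then show ?case using insert by (auto intro: divides_mult)
qed simp

text \<open>Erdos' induction: for \<open>n = 2 * m + 1\<close> the primes in
  \<open>(m + 1, n]\<close> all divide \<open>n choose m\<close>, and this coefficient appears twice
  in a row with sum \<open>2 * 4 ^ m\<close>. An even \<open>n > 2\<close> is not prime and falls
  back to \<open>n - 1\<close>.\<close>

lemma primorial_le: "\<Prod>{q. prime q \<and> q \<le> n} \<le> (4::nat) ^ n"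
proof (induction n rule: less_induct)
  case (less n)
  consider "n \<le> 2" | "n > 2" "even n" | "n > 2" "odd n" by force
  then show ?case
  proof cases
    case 1
    have "{q::nat. prime q \<and> q \<le> n} \<subseteq> {2}" using 1 by (auto dest: prime_ge_2_nat)
    then have "{q::nat. prime q \<and> q \<le> n} = {} \<or> {q::nat. prime q \<and> q \<le> n} = {2}" by blast
    moreover have "2 \<le> n" if "{q::nat. prime q \<and> q \<le> n} = {2}" using that by blast
    ultimately show ?thesis
    proof (elim disjE)
      assume eq: "{q::nat. prime q \<and> q \<le> n} = {}"
      show ?thesis unfolding eq by simp
    next
      assume eq: "{q::nat. prime q \<and> q \<le> n} = {2}"
      then have "n = 2" using 1 \<open>_ \<Longrightarrow> 2 \<le> n\<close> by simp
      then show ?thesis unfolding eq by simp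
    qed
  next
    case 2
    have "\<not> prime n" using 2 prime_odd_nat by blast
    then have eq: "{q. prime q \<and> q \<le> n} = {q. prime q \<and> q \<le> n - 1}"
      by (auto simp: le_eq_less_or_eq[of _ n])
    have "\<Prod>{q. prime q \<and> q \<le> n - 1} \<le> 4 ^ (n - 1)" using 2 by (intro less) auto
    also have "\<dots> \<le> 4 ^ n" by (rule power_increasing) auto
    finally show ?thesis by (simp only: eq)
  next
    case 3
    then obtain m where m: "n = 2 * m + 1" by (auto elim: oddE)
    then have "m > 0" using 3 by auto
    define A where "A = {q::nat. prime q \<and> m + 1 < q \<and> q \<le> n}"
    have split: "{q. prime q \<and> q \<le> n} = {q. prime q \<and> q \<le> m + 1} \<union> A"
      using m by (auto simp: A_def)
    have finA: "finite A" by (simp add: A_def)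
    have "q dvd n choose m" if "q \<in> A" for q
    proof -
      have q: "prime q" "m + 1 < q" "q \<le> n" using that by (auto simp: A_def)
      have "fact m * fact (n - m) * (n choose m) = (fact n :: nat)"
        by (rule binomial_fact_lemma) (simp add: m)
      moreover have "q dvd fact n" using q by (simp add: prime_dvd_fact_iff)
      moreover have "\<not> q dvd fact m" "\<not> q dvd fact (n - m)"
        using q m by (simp_all add: prime_dvd_fact_iff del: fact_Suc)
      ultimately show ?thesis using q by (metis prime_dvd_mult_iff)
    qed
    then have "\<Prod>A dvd n choose m" by (intro prod_primes_dvd finA) (auto simp: A_def)
    then have "\<Prod>A \<le> n choose m" by (rule dvd_imp_le) (simp add: m)
    also have "n choose m \<le> 4 ^ m"
    proof -
      have "(n choose m) + (n choose (m + 1)) = (\<Sum>k\<in>{m, m + 1}. n choose k)" by simp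
      also have "\<dots> \<le> (\<Sum>k\<le>n. n choose k)" by (rule sum_mono2) (auto simp: m)
      also have "\<dots> = 2 * 4 ^ m" unfolding choose_row_sum by (simp add: m power_mult)
      finally show ?thesis using binomial_symmetric[of m n] by (simp add: m)
    qed
    finally have A: "\<Prod>A \<le> 4 ^ m" .
    have "\<Prod>{q. prime q \<and> q \<le> n} = \<Prod>{q. prime q \<and> q \<le> m + 1} * \<Prod>A"
      unfolding split using finA by (intro prod.union_disjoint) (auto simp: A_def)
    also have "\<dots> \<le> 4 ^ (m + 1) * 4 ^ m"
      using A m \<open>m > 0\<close> by (intro mult_mono less) auto
    also have "\<dots> = 4 ^ n" by (simp add: m power_add[symmetric])
    finally show ?thesis .
  qed
qed

text \<open>
  In Leibniz' harmonic triangle the reciprocals of \<open>Suc n * (n choose k)\<close> are integer combinations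
  of unit fractions with denominators at most \<open>Suc n\<close>.
\<close>

lemma Suc_times_binomial_dvd:
  fixes L :: nat
  assumes "\<And>j. 1 \<le> j \<Longrightarrow> j \<le> Suc n \<Longrightarrow> j dvd L" and "k \<le> n"
  shows "Suc n * (n choose k) dvd L"
proof -
  have "real L / (real (Suc n) * real (n choose k)) \<in> \<int>"
    using assms
  proof (induction k arbitrary: n)
    case 0
    have "Suc n dvd L" by (rule "0.prems") auto
    then obtain c where "L = Suc n * c" by (rule dvdE)
    then have "real L / (real (Suc n) * real (n choose 0)) = real c"
      by (simp only: binomial_n_0 of_nat_mult of_nat_1) simp
    then show ?case by simp
  next
    case (Suc k)
    then obtain n' where n: "n = Suc n'" by (cases n) auto
    have k: "k \<le> n'" using Suc n by simp
    have "real L / (real (Suc n') * real (n' choose k)) \<in> \<int>" "real L / (real (Suc n) * real (n choose k)) \<in> \<int>"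
      by (rule Suc.IH; use Suc.prems n in auto)+
    \<comment> \<open>Each entry of the triangle is the sum of its two neighbours in the next row;
      solving for the right neighbour passes from \<open>k\<close> to \<open>Suc k\<close>.\<close>
    then have "real L / (real (Suc n') * real (n' choose k)) - real L / (real (Suc n) * real (n choose k)) \<in> \<int>"
      by (rule Ints_diff)
    also have "real L / (real (Suc n') * real (n' choose k)) - real L / (real (Suc n) * real (n choose k))
        = real L / (real (Suc n) * real (n choose Suc k))"
    proof -
      define a b c where "a = real (n' choose k)" and "b = real (n choose k)" and "c = real (n choose Suc k)"
      have pos: "a > 0" "b > 0" "c > 0" using k n by (auto simp: a_def b_def c_def simp del: binomial_Suc_Suc)
      have "Suc k * (n choose Suc k) = n * (n' choose k)"
        using Suc_times_binomial_eq[of n' k] n by (simp add: ac_simps)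
      then have e1: "(real k + 1) * c = (real n' + 1) * a"
        unfolding a_def c_def by (metis n of_nat_Suc of_nat_mult add.commute)
      have "(n - k) * (n choose k) = n * (n' choose k)"
        using binomial_absorb_comp[of n k] n by simp
      then have e2: "(real n' + 1 - k) * b = (real n' + 1) * a"
        unfolding a_def b_def using k n
        by (metis Suc_diff_le le_SucI of_nat_Suc of_nat_diff of_nat_mult add.commute)
      define u where "u = real n' + 1"
      have u: "u > 0" "u - k > 0" using k by (auto simp: u_def)
      have "1 / b = (u - k) / (u * a)" "1 / c = (real k + 1) / (u * a)"
        using e1 e2 u pos by (simp_all add: frac_eq_eq u_def)
      then have "1 / b + 1 / c = (u + 1) / (u * a)"
        by (simp add: add_divide_distrib[symmetric])
      then have "real L / (u + 1) * (1 / b + 1 / c) = real L / (u + 1) * ((u + 1) / (u * a))" by (rule arg_cong)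
      also have "\<dots> = real L / (u * a)" using u by simp
      finally have "real L / (u * a) - real L / ((u + 1) * b) = real L / ((u + 1) * c)"
        by (simp add: distrib_left)
      then show ?thesis by (simp add: a_def b_def c_def u_def n ac_simps del: binomial_Suc_Suc)
    qed
    finally show ?case .
  qed
  then obtain c :: int where "real L / (real (Suc n) * real (n choose k)) = of_int c" by (auto elim: Ints_cases)
  then have "real L = of_int c * (real (Suc n) * real (n choose k))"
    using assms(2) by (simp add: field_simps del: of_nat_Suc)
  then have "real_of_int (int L) = real_of_int (c * int (Suc n * (n choose k)))"
    by (simp only: of_int_mult of_int_of_nat_eq of_nat_mult)
  then have "int L = c * int (Suc n * (n choose k))" by (simp only: of_int_eq_iff)
  then have "int (Suc n * (n choose k)) dvd int L" by (simp only: dvd_triv_right)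
  then show ?thesis by (simp only: int_dvd_int_iff)
qed

text \<open>Nair's bound: \<open>2 * m + 1\<close> times the central coefficient divides
  \<open>L\<close> and, that coefficient being the largest of its row, is at least the row
  sum.\<close>

lemma four_power_le_common_multiple:
  fixes L :: nat
  assumes "\<And>j. 1 \<le> j \<Longrightarrow> j \<le> 2 * m + 1 \<Longrightarrow> j dvd L" and "L > 0"
  shows "4 ^ m \<le> L"
proof -
  have "(4::nat) ^ m = (\<Sum>k\<le>2 * m. (2 * m) choose k)"
    by (simp add: choose_row_sum power_mult)
  also have "\<dots> \<le> (\<Sum>k\<le>2 * m. (2 * m) choose m)"
    by (rule sum_mono) (metis binomial_maximum nonzero_mult_div_cancel_left zero_neq_numeral)
  also have "\<dots> = Suc (2 * m) * ((2 * m) choose m)" by simp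
  also have "\<dots> \<le> L"
    by (rule dvd_imp_le[OF Suc_times_binomial_dvd]) (use assms in auto)
  finally show ?thesis .
qed

text \<open>Without a prime in the interval, the least common multiple of the numbers up to
  \<open>2 * m + 1\<close> is too small: each prime below \<open>r\<close> contributes a power of at
  most \<open>2 * m + 1\<close>, and the others enter only to the first power because their squares
  exceed \<open>2 * m + 1\<close>, so together they contribute at most the primorial of
  \<open>n\<close>.\<close>

lemma prime_between:
  fixes n m r :: nat
  assumes r: "2 * m + 1 < r ^ 2" and big: "(2 * m + 1) ^ r * 4 ^ n < 4 ^ m"
  shows "\<exists>q. prime q \<and> n < q \<and> q \<le> 2 * m + 1"
proof (rule ccontr)
  assume none: "\<not> ?thesis"
  define K where "K = 2 * m + 1"
  \<comment> \<open>For a prime \<open>q\<close> this is its exponent in the least common multiple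
    of \<open>1, ..., K\<close>.\<close>
  define e where "e q = Max {i. q ^ i \<le> K}" for q :: nat
  define P where "P = {q::nat. prime q \<and> q \<le> K}"
  have finP: "finite P" by (simp add: P_def)
  have fin: "finite {i. q ^ i \<le> K}" if "q \<ge> 2" for q :: nat
  proof (rule finite_subset)
    show "{i. q ^ i \<le> K} \<subseteq> {..K}"
    proof
      fix i assume "i \<in> {i. q ^ i \<le> K}"
      then have "q ^ i \<le> K" by simp
      moreover have "i < 2 ^ i" by (rule less_exp)
      moreover have "2 ^ i \<le> q ^ i" using that by (rule power_mono) simp
      ultimately have "i \<le> K" by (meson le_trans less_imp_le_nat)
      then show "i \<in> {..K}" by simp
    qed
  qed simp
  have e_le: "q ^ e q \<le> K" if "q \<in> P" for q
  proof -
    have "q \<ge> 2" using that by (auto simp: P_def prime_ge_2_nat)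
    moreover have "0 \<in> {i. q ^ i \<le> K}" by (simp add: K_def)
    ultimately have "e q \<in> {i. q ^ i \<le> K}" unfolding e_def by (intro Max_in fin) (assumption, blast)
    then show ?thesis by simp
  qed
  define L where "L = (\<Prod>q\<in>P. q ^ e q)"
  have "L > 0" unfolding L_def by (intro prod_pos) (auto simp: P_def prime_gt_0_nat)
  have "j dvd L" if j: "1 \<le> j" "j \<le> K" for j
  proof -
    have "j = (\<Prod>q\<in>prime_factors j. q ^ multiplicity q j)"
      using j by (simp add: prod_prime_factors)
    also have "\<dots> dvd (\<Prod>q\<in>prime_factors j. q ^ e q)"
    proof (rule prod_dvd_prod)
      fix q assume q: "q \<in> prime_factors j"
      then have "q \<ge> 2" using prime_ge_2_nat by auto
      have "q ^ multiplicity q j \<le> j" using j by (intro dvd_imp_le multiplicity_dvd) auto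
      then have "multiplicity q j \<le> e q"
        unfolding e_def using j \<open>q \<ge> 2\<close> by (intro Max_ge fin) auto
      then show "q ^ multiplicity q j dvd q ^ e q" by (rule le_imp_power_dvd)
    qed
    also have "\<dots> dvd L" unfolding L_def
    proof (rule prod_dvd_prod_subset[OF finP])
      show "prime_factors j \<subseteq> P"
        using j by (auto simp: P_def in_prime_factors_iff dest!: dvd_imp_le)
    qed
    finally show ?thesis .
  qed
  then have "4 ^ m \<le> L" using \<open>L > 0\<close> by (intro four_power_le_common_multiple) (auto simp: K_def)
  also have "L \<le> (\<Prod>q\<in>P. (if q < r then K else 1) * (if q < r then 1 else q))"
    unfolding L_def
  proof (rule prod_mono, rule conjI)
    fix q assume q: "q \<in> P"
    show "q ^ e q \<le> (if q < r then K else 1) * (if q < r then 1 else q)"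
    proof (cases "q < r")
      case False
      have "e q < 2"
      proof (rule ccontr)
        assume "\<not> e q < 2"
        then have "q ^ 2 \<le> q ^ e q" using q by (intro power_increasing) (auto simp: P_def dest: prime_ge_1_nat)
        moreover have "r ^ 2 \<le> q ^ 2" using False by (intro power_mono) auto
        ultimately show False using e_le[OF q] r unfolding K_def by linarith
      qed
      then have "q ^ e q \<le> q ^ 1" using q by (intro power_increasing) (auto simp: P_def dest: prime_ge_1_nat)
      then show ?thesis using False by simp
    qed (use e_le[OF q] in auto)
  qed simp
  also have "\<dots> = (\<Prod>q\<in>P. if q < r then K else 1) * (\<Prod>q\<in>P. if q < r then 1 else q)"
    by (rule prod.distrib)
  also have "\<dots> \<le> K ^ r * 4 ^ n"
  proof (rule mult_mono)
    have "(\<Prod>q\<in>P. if q < r then K else 1) = K ^ card (P \<inter> {q. q < r})"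
      using finP by (simp add: prod.If_cases)
    also have "\<dots> \<le> K ^ r"
      using card_mono[of "{..<r}" "P \<inter> {q. q < r}"] by (intro power_increasing) (auto simp: K_def)
    finally show "(\<Prod>q\<in>P. if q < r then K else 1) \<le> K ^ r" .
    have "P \<subseteq> {q. prime q \<and> q \<le> n}" using none by (auto simp: P_def K_def not_less[symmetric])
    have "(\<Prod>q\<in>P. if q < r then 1 else q) \<le> \<Prod>P"
      by (rule prod_mono) (auto simp: P_def prime_gt_0_nat Suc_leI)
    also have "\<dots> \<le> \<Prod>{q. prime q \<and> q \<le> n}"
    proof (rule dvd_imp_le)
      show "\<Prod>P dvd \<Prod>{q. prime q \<and> q \<le> n}"
        by (rule prod_dvd_prod_subset) (use \<open>P \<subseteq> _\<close> in auto)
      show "0 < \<Prod>{q::nat. prime q \<and> q \<le> n}" by (rule prod_pos) (simp add: prime_gt_0_nat)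
    qed
    also have "\<dots> \<le> 4 ^ n" by (rule primorial_le)
    finally show "(\<Prod>q\<in>P. if q < r then 1 else q) \<le> 4 ^ n" .
  qed auto
  finally show False using big by (simp add: K_def)
qed

text \<open>With \<open>m\<close> near \<open>0.35 * t\<close> the exponent \<open>n\<close> only
  has to stay below \<open>m\<close> by a fixed fraction of \<open>t\<close>; \<open>0.32\<close>
  leaves room for the subexponential contribution of the small primes, and rounding turns it into
  \<open>0.31\<close>.\<close>

lemma eventually_prime_in_range:
  "\<forall>\<^sub>F t in sequentially. \<exists>p::nat. prime p \<and> odd p \<and> 31 / 100 * real t \<le> p \<and> p \<le> 7 / 10 * real t"
proof -
  have ev: "\<forall>\<^sub>F t::nat in sequentially. real t powr (sqrt t + 1) * 4 powr (32 / 100 * real t) < 4 powr (35 / 100 * real t - 2)"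
    by real_asymp
  have ev': "\<forall>\<^sub>F t::nat in sequentially. real t \<ge> 100"
    by real_asymp
  from ev ev' show ?thesis
  proof eventually_elim
    case (elim t)
    define m where "m = nat \<lfloor>35 / 100 * real t - 1\<rfloor>"
    define n where "n = nat \<lfloor>32 / 100 * real t\<rfloor>"
    define r where "r = nat \<lfloor>sqrt t + 1\<rfloor>"
    have m: "real m \<le> 35 / 100 * real t - 1" "real m \<ge> 35 / 100 * real t - 2"
      using elim unfolding m_def by linarith+
    have n: "real n \<le> 32 / 100 * real t" "real n \<ge> 32 / 100 * real t - 1"
      using elim unfolding n_def by linarith+
    have "sqrt t \<ge> 0" by simp
    then have r: "real r \<le> sqrt t + 1" "real r > sqrt t"
      unfolding r_def by linarith+
    have t: "real (2 * m + 1) \<le> t" using m elim by simp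
    have "real t = sqrt t ^ 2" by simp
    also have "\<dots> < real r ^ 2" using r by (intro power_strict_mono) auto
    finally have "real (2 * m + 1) < real (r ^ 2)" using t unfolding of_nat_power by linarith
    then have 1: "2 * m + 1 < r ^ 2" by (simp only: of_nat_less_iff)
    have "real ((2 * m + 1) ^ r * 4 ^ n) = real (2 * m + 1) powr r * 4 powr n"
      by (simp only: of_nat_mult of_nat_power powr_realpow) (simp add: powr_realpow)
    also have "\<dots> \<le> real t powr (sqrt t + 1) * 4 powr (32 / 100 * t)"
    proof (rule mult_mono)
      have "real (2 * m + 1) powr r \<le> real t powr r" using t by (intro powr_mono2) auto
      also have "\<dots> \<le> real t powr (sqrt t + 1)" using r elim by (intro powr_mono) auto
      finally show "real (2 * m + 1) powr r \<le> real t powr (sqrt t + 1)" .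
      show "4 powr real n \<le> 4 powr (32 / 100 * t)" using n by (intro powr_mono) auto
    qed auto
    also have "\<dots> < 4 powr (35 / 100 * real t - 2)" using elim by simp
    also have "\<dots> \<le> 4 powr real m" using m by (intro powr_mono) auto
    also have "\<dots> = real (4 ^ m)" by (simp add: powr_realpow)
    finally have "(2 * m + 1) ^ r * 4 ^ n < 4 ^ m" by (simp only: of_nat_less_iff)
    from prime_between[OF 1 this] obtain q where q: "prime q" "n < q" "q \<le> 2 * m + 1" by blast
    have "real q \<ge> 31 / 100 * real t" using q n elim by linarith
    moreover have "real q \<le> 7 / 10 * real t" using q m elim by linarith
    moreover have "odd q" using q n elim by (intro prime_odd_nat) linarith+
    ultimately show ?case using q(1) by (intro exI[of _ q] conjI)
  qed
qed

section \<open>Words without orthogonal pairs\<close>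

text \<open>Pigeonhole in place of linear algebra: the \<open>p ^ card I\<close> coefficient vectors
  outnumber the \<open>p ^ card J\<close> possible values, and the difference of two vectors with
  the same value is the dependency. Its entries lie strictly between \<open>-p\<close> and
  \<open>p\<close>, so a nonzero one is not divisible by \<open>p\<close>.\<close>

lemma exists_dependency_mod:
  fixes a :: "'i \<Rightarrow> 'j \<Rightarrow> int" and p :: nat
  assumes finI: "finite I" and finJ: "finite J" and less: "card J < card I" and p: "1 < p"
  shows "\<exists>c. (\<exists>i\<in>I. \<not> int p dvd c i) \<and> (\<forall>j\<in>J. int p dvd (\<Sum>i\<in>I. c i * a i j))"
proof -
  define T where "T = {0..<int p}"
  define \<phi> where "\<phi> c = (\<lambda>j\<in>J. (\<Sum>i\<in>I. c i * a i j) mod int p)" for c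
  have "\<not> inj_on \<phi> (I \<rightarrow>\<^sub>E T)"
  proof
    assume inj: "inj_on \<phi> (I \<rightarrow>\<^sub>E T)"
    have "\<phi> ` (I \<rightarrow>\<^sub>E T) \<subseteq> J \<rightarrow>\<^sub>E T" using p by (auto simp: \<phi>_def T_def)
    then have "card (I \<rightarrow>\<^sub>E T) \<le> card (J \<rightarrow>\<^sub>E T)"
      using inj finJ by (intro card_inj_on_le[of \<phi>]) (auto simp: T_def intro!: finite_PiE)
    then have "p ^ card I \<le> p ^ card J" using finI finJ by (simp add: card_PiE T_def)
    then show False using less p by simp
  qed
  then obtain u v where uv: "u \<in> I \<rightarrow>\<^sub>E T" "v \<in> I \<rightarrow>\<^sub>E T" "u \<noteq> v" "\<phi> u = \<phi> v"
    by (auto simp: inj_on_def)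
  then obtain i where i: "i \<in> I" "u i \<noteq> v i" by (meson PiE_ext)
  have "u i \<in> T" "v i \<in> T" using uv i by auto
  then have "\<bar>u i - v i\<bar> < int p" by (auto simp: T_def)
  then have "\<not> int p dvd u i - v i" using i(2) by (auto dest: dvd_imp_le_int[rotated])
  moreover have "int p dvd (\<Sum>i\<in>I. (u i - v i) * a i j)" if "j \<in> J" for j
  proof -
    have "(\<Sum>i\<in>I. u i * a i j) mod int p = (\<Sum>i\<in>I. v i * a i j) mod int p"
      using fun_cong[OF uv(4), of j] that by (simp add: \<phi>_def)
    then have "int p dvd (\<Sum>i\<in>I. u i * a i j) - (\<Sum>i\<in>I. v i * a i j)" by (simp add: mod_eq_dvd_iff)
    then show ?thesis by (simp add: left_diff_distrib sum_subtractf)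
  qed
  ultimately show ?thesis using i(1) by (intro exI[of _ "\<lambda>i. u i - v i"]) auto
qed

section \<open>Words and reduced polynomial functions on them\<close>

definition letters :: "(int \<times> int) set" where
  "letters = {(0, 0), (1, 0), (-1, 0), (0, 1), (0, -1)}"

definition word_supp :: "nat \<Rightarrow> (nat \<Rightarrow> int \<times> int) \<Rightarrow> nat set" where
  "word_supp t x = {j\<in>{..<t}. x j \<noteq> (0, 0)}"

definition words :: "nat \<Rightarrow> nat \<Rightarrow> (nat \<Rightarrow> int \<times> int) set" where
  "words t p = {x \<in> {..<t} \<rightarrow>\<^sub>E letters. card (word_supp t x) = p}"

definition word_inner :: "nat \<Rightarrow> (nat \<Rightarrow> int \<times> int) \<Rightarrow> (nat \<Rightarrow> int \<times> int) \<Rightarrow> int" where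
  "word_inner t x y = (\<Sum>j<t. fst (x j) * fst (y j) + snd (x j) * snd (y j))"

text \<open>A letter \<open>(a, b)\<close> satisfies \<open>a * b = 0\<close>,
  \<open>a ^ 3 = a\<close> and \<open>b ^ 3 = b\<close>, so these five monomials in one plane
  suffice for all polynomial functions on \<open>letters\<close>.\<close>

definition exponents :: "(nat \<times> nat) set" where
  "exponents = {(0, 0), (1, 0), (0, 1), (2, 0), (0, 2)}"

definition monomials :: "nat \<Rightarrow> nat \<Rightarrow> (nat \<Rightarrow> nat \<times> nat) set" where
  "monomials t r = {m \<in> {..<t} \<rightarrow>\<^sub>E exponents. (\<Sum>j<t. fst (m j) + snd (m j)) \<le> r}"

definition monomial_val :: "nat \<Rightarrow> (nat \<Rightarrow> nat \<times> nat) \<Rightarrow> (nat \<Rightarrow> int \<times> int) \<Rightarrow> int" where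
  "monomial_val t m y = (\<Prod>j<t. fst (y j) ^ fst (m j) * snd (y j) ^ snd (m j))"

text \<open>Equality is asked for only on words, so the relations between the coordinates of a
  letter are built in. The coefficients are integers; the modulus enters only with the dimension
  count.\<close>

definition spanned :: "nat \<Rightarrow> nat \<Rightarrow> ((nat \<Rightarrow> int \<times> int) \<Rightarrow> int) \<Rightarrow> bool" where
  "spanned t r f \<longleftrightarrow>
     (\<exists>c. \<forall>y\<in>{..<t} \<rightarrow>\<^sub>E letters. f y = (\<Sum>m\<in>monomials t r. c m * monomial_val t m y))"

lemma finite_letters: "finite letters" and finite_exponents: "finite exponents"
  by (auto simp: letters_def exponents_def)

lemma card_nonzero_letters: "card (letters - {(0, 0)}) = 4"
  by (simp add: letters_def)

lemma finite_words: "finite (words t p)"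
  unfolding words_def by (rule finite_subset[of _ "{..<t} \<rightarrow>\<^sub>E letters"]) (auto intro!: finite_PiE finite_letters)

lemma finite_monomials: "finite (monomials t r)"
  unfolding monomials_def by (rule finite_subset[of _ "{..<t} \<rightarrow>\<^sub>E exponents"]) (auto intro!: finite_PiE finite_exponents)

lemma spanned_add:
  assumes "spanned t r f" "spanned t r g"
  shows "spanned t r (\<lambda>y. f y + g y)"
proof -
  obtain c d where "\<And>y. y \<in> {..<t} \<rightarrow>\<^sub>E letters \<Longrightarrow> f y = (\<Sum>m\<in>monomials t r. c m * monomial_val t m y)"
    "\<And>y. y \<in> {..<t} \<rightarrow>\<^sub>E letters \<Longrightarrow> g y = (\<Sum>m\<in>monomials t r. d m * monomial_val t m y)"
    using assms by (auto simp: spanned_def)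
  then show ?thesis unfolding spanned_def
    by (intro exI[of _ "\<lambda>m. c m + d m"]) (simp add: distrib_right sum.distrib)
qed

lemma spanned_scale:
  assumes "spanned t r f"
  shows "spanned t r (\<lambda>y. a * f y)"
proof -
  obtain c where "\<And>y. y \<in> {..<t} \<rightarrow>\<^sub>E letters \<Longrightarrow> f y = (\<Sum>m\<in>monomials t r. c m * monomial_val t m y)"
    using assms by (auto simp: spanned_def)
  then show ?thesis unfolding spanned_def
    by (intro exI[of _ "\<lambda>m. a * c m"]) (simp add: sum_distrib_left mult.assoc)
qed

lemma spanned_monomial:
  assumes "m \<in> monomials t r"
  shows "spanned t r (monomial_val t m)"
  unfolding spanned_def using assms finite_monomials
  by (intro exI[of _ "\<lambda>m'. if m' = m then 1 else 0"]) (simp add: if_distrib[of "\<lambda>u. u * _"] cong: if_cong)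

lemma spanned_sum:
  assumes "finite S" and "\<And>i. i \<in> S \<Longrightarrow> spanned t r (f i)"
  shows "spanned t r (\<lambda>y. \<Sum>i\<in>S. f i y)"
  using assms
proof (induction S rule: finite_induct)
  case empty
  show ?case unfolding spanned_def by (rule exI[of _ "\<lambda>_. 0"]) simp
qed (auto intro: spanned_add)

lemma spanned_cong:
  assumes "spanned t r f" and "\<And>y. y \<in> {..<t} \<rightarrow>\<^sub>E letters \<Longrightarrow> f y = g y"
  shows "spanned t r g"
  using assms by (auto simp: spanned_def)

lemma spanned_Suc:
  assumes "spanned t r f"
  shows "spanned t (Suc r) f"
proof -
  obtain c where c: "\<And>y. y \<in> {..<t} \<rightarrow>\<^sub>E letters \<Longrightarrow> f y = (\<Sum>m\<in>monomials t r. c m * monomial_val t m y)"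
    using assms by (auto simp: spanned_def)
  have "spanned t (Suc r) (\<lambda>y. \<Sum>m\<in>monomials t r. c m * monomial_val t m y)"
    by (intro spanned_sum finite_monomials spanned_scale spanned_monomial) (auto simp: monomials_def)
  then show ?thesis by (rule spanned_cong) (simp add: c)
qed

text \<open>The relations of a letter reduce the product to one admissible monomial or to zero
  (\<open>s = 0\<close>). Reducing a cube even lowers the degree.\<close>

lemma coordinate_times_block_monomial:
  assumes "e \<in> exponents" and "\<kappa> = fst \<or> \<kappa> = snd"
  shows "\<exists>s e'. e' \<in> exponents \<and> fst e' + snd e' \<le> Suc (fst e + snd e) \<and>
    (\<forall>u\<in>letters. \<kappa> u * (fst u ^ fst e * snd u ^ snd e) = s * (fst u ^ fst e' * snd u ^ snd e'))"
proof -
  consider "\<kappa> = fst" "e = (0, 0)" | "\<kappa> = fst" "e = (1, 0)" | "\<kappa> = fst" "e = (2, 0)"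
    | "\<kappa> = snd" "e = (0, 0)" | "\<kappa> = snd" "e = (0, 1)" | "\<kappa> = snd" "e = (0, 2)"
    | "\<kappa> = fst" "snd e > 0" | "\<kappa> = snd" "fst e > 0"
    using assms by (auto simp: exponents_def)
  then show ?thesis
  proof cases
    case 1 then show ?thesis by (intro exI[of _ 1] exI[of _ "(1, 0)"]) (auto simp: exponents_def)
  next
    case 2 then show ?thesis by (intro exI[of _ 1] exI[of _ "(2, 0)"]) (auto simp: exponents_def power2_eq_square)
  next
    case 3 then show ?thesis by (intro exI[of _ 1] exI[of _ "(1, 0)"]) (auto simp: exponents_def letters_def)
  next
    case 4 then show ?thesis by (intro exI[of _ 1] exI[of _ "(0, 1)"]) (auto simp: exponents_def)
  next
    case 5 then show ?thesis by (intro exI[of _ 1] exI[of _ "(0, 2)"]) (auto simp: exponents_def power2_eq_square)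
  next
    case 6 then show ?thesis by (intro exI[of _ 1] exI[of _ "(0, 1)"]) (auto simp: exponents_def letters_def)
  next
    case 7 then show ?thesis by (intro exI[of _ 0] exI[of _ "(0, 0)"]) (auto simp: exponents_def letters_def)
  next
    case 8 then show ?thesis by (intro exI[of _ 0] exI[of _ "(0, 0)"]) (auto simp: exponents_def letters_def)
  qed
qed

lemma spanned_coordinate_times_monomial:
  assumes m: "m \<in> monomials t r" and i: "i < t" and \<kappa>: "\<kappa> = fst \<or> \<kappa> = snd"
  shows "spanned t (Suc r) (\<lambda>y. \<kappa> (y i) * monomial_val t m y)"
proof -
  have mE: "m \<in> {..<t} \<rightarrow>\<^sub>E exponents" and md: "(\<Sum>j<t. fst (m j) + snd (m j)) \<le> r"
    using m by (auto simp: monomials_def)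
  have "m i \<in> exponents" using mE i by auto
  from coordinate_times_block_monomial[OF this \<kappa>] obtain s e where
    e: "e \<in> exponents" "fst e + snd e \<le> Suc (fst (m i) + snd (m i))"
    and eq: "\<And>u. u \<in> letters \<Longrightarrow> \<kappa> u * (fst u ^ fst (m i) * snd u ^ snd (m i)) = s * (fst u ^ fst e * snd u ^ snd e)"
    by blast
  define m' where "m' = m(i := e)"
  have i': "i \<in> {..<t}" using i by simp
  have "(\<Sum>j<t. fst (m' j) + snd (m' j)) = (fst e + snd e) + (\<Sum>j\<in>{..<t} - {i}. fst (m j) + snd (m j))"
    by (subst sum.remove[OF finite_lessThan i']) (simp add: m'_def)
  moreover have "(\<Sum>j<t. fst (m j) + snd (m j)) = (fst (m i) + snd (m i)) + (\<Sum>j\<in>{..<t} - {i}. fst (m j) + snd (m j))"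
    by (rule sum.remove[OF finite_lessThan i'])
  ultimately have "(\<Sum>j<t. fst (m' j) + snd (m' j)) \<le> Suc r" using e md by simp
  moreover have "m' \<in> {..<t} \<rightarrow>\<^sub>E exponents"
    using mE e i by (auto simp: m'_def PiE_def extensional_def)
  ultimately have "m' \<in> monomials t (Suc r)" by (simp add: monomials_def)
  then have "spanned t (Suc r) (\<lambda>y. s * monomial_val t m' y)" by (intro spanned_scale spanned_monomial)
  then show ?thesis
  proof (rule spanned_cong)
    fix y assume "y \<in> {..<t} \<rightarrow>\<^sub>E letters"
    then have "y i \<in> letters" using i by auto
    have "monomial_val t m' y = (fst (y i) ^ fst e * snd (y i) ^ snd e)
        * (\<Prod>j\<in>{..<t} - {i}. fst (y j) ^ fst (m j) * snd (y j) ^ snd (m j))"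
      unfolding monomial_val_def by (subst prod.remove[OF finite_lessThan i']) (simp add: m'_def)
    moreover have "monomial_val t m y = (fst (y i) ^ fst (m i) * snd (y i) ^ snd (m i))
        * (\<Prod>j\<in>{..<t} - {i}. fst (y j) ^ fst (m j) * snd (y j) ^ snd (m j))"
      unfolding monomial_val_def by (rule prod.remove[OF finite_lessThan i'])
    ultimately show "s * monomial_val t m' y = \<kappa> (y i) * monomial_val t m y"
      using eq[OF \<open>y i \<in> letters\<close>] by (simp add: mult.assoc[symmetric])
  qed
qed

lemma spanned_coordinate_times:
  assumes f: "spanned t r f" and i: "i < t" and \<kappa>: "\<kappa> = fst \<or> \<kappa> = snd"
  shows "spanned t (Suc r) (\<lambda>y. \<kappa> (y i) * f y)"
proof -
  obtain c where c: "\<And>y. y \<in> {..<t} \<rightarrow>\<^sub>E letters \<Longrightarrow> f y = (\<Sum>m\<in>monomials t r. c m * monomial_val t m y)"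
    using assms by (auto simp: spanned_def)
  have "spanned t (Suc r) (\<lambda>y. \<Sum>m\<in>monomials t r. c m * (\<kappa> (y i) * monomial_val t m y))"
    by (intro spanned_sum finite_monomials spanned_scale spanned_coordinate_times_monomial i \<kappa>)
  then show ?thesis by (rule spanned_cong) (simp add: c sum_distrib_left mult.left_commute)
qed

text \<open>Each factor is affine in the coordinates of \<open>y\<close> and costs one degree. For
  \<open>n = p - 1\<close> and \<open>p\<close> prime, the product is divisible by \<open>p\<close>
  exactly when the inner product is not.\<close>

lemma spanned_prod_word_inner:
  "spanned t n (\<lambda>y. \<Prod>i\<in>{1..n}. word_inner t x y - int i)"
proof (induction n)
  case 0
  have zero: "(\<lambda>j\<in>{..<t}. (0, 0)) \<in> monomials t 0" by (auto simp: monomials_def exponents_def)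
  show ?case by (rule spanned_cong[OF spanned_monomial[OF zero]]) (simp add: monomial_val_def)
next
  case (Suc n)
  let ?f = "\<lambda>y. \<Prod>i\<in>{1..n}. word_inner t x y - int i"
  have "spanned t (Suc n) (\<lambda>y. (\<Sum>j<t. fst (x j) * (fst (y j) * ?f y) + snd (x j) * (snd (y j) * ?f y))
      + (- int (Suc n)) * ?f y)"
    by (intro spanned_add spanned_sum spanned_scale spanned_coordinate_times spanned_Suc Suc) auto
  then show ?case
  proof (rule spanned_cong)
    fix y
    have "(\<Sum>j<t. fst (x j) * (fst (y j) * ?f y) + snd (x j) * (snd (y j) * ?f y)) = word_inner t x y * ?f y"
      by (simp add: word_inner_def sum_distrib_right algebra_simps)
    then show "(\<Sum>j<t. fst (x j) * (fst (y j) * ?f y) + snd (x j) * (snd (y j) * ?f y)) + (- int (Suc n)) * ?f y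
        = (\<Prod>i\<in>{1..Suc n}. word_inner t x y - int i)"
      by (simp add: atLeastAtMostSuc_conv algebra_simps)
  qed
qed

section \<open>Inner products of words modulo the weight\<close>

lemma word_norm:
  assumes "x \<in> words t p"
  shows "(\<Sum>j<t. fst (x j) ^ 2 + snd (x j) ^ 2) = int p"
proof -
  have "(\<Sum>j<t. fst (x j) ^ 2 + snd (x j) ^ 2) = (\<Sum>j<t. if x j \<noteq> (0, 0) then 1 else 0)"
  proof (rule sum.cong)
    fix j assume "j \<in> {..<t}"
    then have "x j \<in> letters" using assms by (auto simp: words_def)
    then show "fst (x j) ^ 2 + snd (x j) ^ 2 = (if x j \<noteq> (0, 0) then 1 else 0)"
      by (auto simp: letters_def)
  qed simp
  also have "\<dots> = int (card (word_supp t x))"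
    by (simp add: sum.If_cases word_supp_def Int_def)
  finally show ?thesis using assms by (simp add: words_def)
qed

lemma word_inner_self:
  assumes "x \<in> words t p"
  shows "word_inner t x x = int p"
  using word_norm[OF assms] by (simp add: word_inner_def power2_eq_square)

lemma words_eqI:
  assumes "x \<in> words t p" "y \<in> words t p" and "\<And>j. j < t \<Longrightarrow> x j = y j"
  shows "x = y"
  using assms by (intro PiE_ext[of x "{..<t}" "\<lambda>_. letters"]) (auto simp: words_def)

text \<open>The squared norm equals the modulus, so Cauchy-Schwarz leaves only the multiples
  \<open>-p\<close>, \<open>0\<close> and \<open>p\<close>. Expanding the squared norms of
  \<open>x + y\<close> and \<open>x - y\<close> gives this together with the cases of
  equality.\<close>

lemma dvd_word_inner_cases:
  assumes x: "x \<in> words t p" and y: "y \<in> words t p" and p: "p > 0" and dvd: "int p dvd word_inner t x y"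
  shows "word_inner t x y = 0 \<or> x = y \<or> (\<forall>j<t. y j = (- fst (x j), - snd (x j)))"
proof -
  have plus: "(\<Sum>j<t. (fst (x j) + fst (y j)) ^ 2 + (snd (x j) + snd (y j)) ^ 2) = 2 * int p + 2 * word_inner t x y"
  proof -
    have "(\<Sum>j<t. (fst (x j) + fst (y j)) ^ 2 + (snd (x j) + snd (y j)) ^ 2)
       = (\<Sum>j<t. fst (x j) ^ 2 + snd (x j) ^ 2) + (\<Sum>j<t. fst (y j) ^ 2 + snd (y j) ^ 2) + 2 * word_inner t x y"
      unfolding word_inner_def sum_distrib_left sum.distrib[symmetric]
      by (rule sum.cong) (auto simp: power2_eq_square algebra_simps)
    then show ?thesis using word_norm[OF x] word_norm[OF y] by simp
  qed
  have minus: "(\<Sum>j<t. (fst (x j) - fst (y j)) ^ 2 + (snd (x j) - snd (y j)) ^ 2) = 2 * int p - 2 * word_inner t x y"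
  proof -
    have "(\<Sum>j<t. (fst (x j) - fst (y j)) ^ 2 + (snd (x j) - snd (y j)) ^ 2)
       = (\<Sum>j<t. fst (x j) ^ 2 + snd (x j) ^ 2) + (\<Sum>j<t. fst (y j) ^ 2 + snd (y j) ^ 2) - 2 * word_inner t x y"
      unfolding word_inner_def sum_distrib_left sum.distrib[symmetric] sum_subtractf[symmetric]
      by (rule sum.cong) (auto simp: power2_eq_square algebra_simps)
    then show ?thesis using word_norm[OF x] word_norm[OF y] by simp
  qed
  obtain q where q: "word_inner t x y = int p * q" using dvd by (rule dvdE)
  have "0 \<le> 2 * int p + 2 * word_inner t x y" unfolding plus[symmetric] by (intro sum_nonneg) simp
  then have "0 \<le> int p * (1 + q)" by (simp add: q algebra_simps)
  then have "-1 \<le> q" using p by (simp add: zero_le_mult_iff)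
  moreover have "0 \<le> 2 * int p - 2 * word_inner t x y" unfolding minus[symmetric] by (intro sum_nonneg) simp
  then have "0 \<le> int p * (1 - q)" by (simp add: q algebra_simps)
  then have "q \<le> 1" using p by (simp add: zero_le_mult_iff)
  ultimately consider "q = 0" | "q = 1" | "q = -1" by linarith
  then show ?thesis
  proof cases
    case 1 then show ?thesis using q by simp
  next
    case 2
    then have "(\<Sum>j<t. (fst (x j) - fst (y j)) ^ 2 + (snd (x j) - snd (y j)) ^ 2) = 0" using minus q by simp
    then have "\<forall>j\<in>{..<t}. (fst (x j) - fst (y j)) ^ 2 + (snd (x j) - snd (y j)) ^ 2 = 0"
      by (subst (asm) sum_nonneg_eq_0_iff) auto
    then have "x j = y j" if "j < t" for j
      using that by (auto simp: sum_power2_eq_zero_iff prod_eq_iff)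
    then show ?thesis using words_eqI[OF x y] by blast
  next
    case 3
    then have "(\<Sum>j<t. (fst (x j) + fst (y j)) ^ 2 + (snd (x j) + snd (y j)) ^ 2) = 0" using plus q by simp
    then have "\<forall>j\<in>{..<t}. (fst (x j) + fst (y j)) ^ 2 + (snd (x j) + snd (y j)) ^ 2 = 0"
      by (subst (asm) sum_nonneg_eq_0_iff) auto
    then have "fst (y j) = - fst (x j) \<and> snd (y j) = - snd (x j)" if "j < t" for j
      using that by (auto simp: sum_power2_eq_zero_iff eq_neg_iff_add_eq_0 add.commute)
    then show ?thesis by (auto simp: prod_eq_iff)
  qed
qed

text \<open>Modulo \<open>p\<close> the matrix \<open>f x y\<close> on \<open>I\<close> is diagonal
  with diagonal entries \<open>(p - 1)!\<close>, hence of full rank, while its rows are combinations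
  of reduced monomials of degree at most \<open>p - 1\<close>.\<close>

lemma card_le_monomials:
  assumes p: "prime p" and I: "I \<subseteq> words t p"
    and ndvd: "\<And>x y. x \<in> I \<Longrightarrow> y \<in> I \<Longrightarrow> x \<noteq> y \<Longrightarrow> \<not> int p dvd word_inner t x y"
  shows "card I \<le> card (monomials t (p - 1))"
proof (rule ccontr)
  assume "\<not> ?thesis"
  then have less: "card (monomials t (p - 1)) < card I" by simp
  have finI: "finite I" using I finite_words by (rule finite_subset)
  define f where "f x y = (\<Prod>i\<in>{1..p - 1}. word_inner t x y - int i)" for x y
  have "\<forall>x. \<exists>c. \<forall>y\<in>{..<t} \<rightarrow>\<^sub>E letters. f x y = (\<Sum>m\<in>monomials t (p - 1). c m * monomial_val t m y)"
    using spanned_prod_word_inner[of t "p - 1"] by (auto simp: spanned_def f_def)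
  from choice[OF this] obtain a where a: "\<And>x y. y \<in> {..<t} \<rightarrow>\<^sub>E letters \<Longrightarrow> f x y = (\<Sum>m\<in>monomials t (p - 1). a x m * monomial_val t m y)"
    by blast
  obtain c where c: "\<exists>x\<in>I. \<not> int p dvd c x" "\<And>m. m \<in> monomials t (p - 1) \<Longrightarrow> int p dvd (\<Sum>x\<in>I. c x * a x m)"
    using exists_dependency_mod[OF finI finite_monomials less prime_gt_1_nat[OF p], of a] by auto
  have pp: "prime (int p)" using p by simp
  have "int p dvd c y" if y: "y \<in> I" for y
  proof -
    have yw: "y \<in> words t p" "y \<in> {..<t} \<rightarrow>\<^sub>E letters" using y I by (auto simp: words_def)
    have "(\<Sum>x\<in>I. c x * f x y) = (\<Sum>x\<in>I. \<Sum>m\<in>monomials t (p - 1). c x * a x m * monomial_val t m y)"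
      by (simp add: a[OF yw(2)] sum_distrib_left mult.assoc)
    also have "\<dots> = (\<Sum>m\<in>monomials t (p - 1). \<Sum>x\<in>I. c x * a x m * monomial_val t m y)"
      by (rule sum.swap)
    also have "\<dots> = (\<Sum>m\<in>monomials t (p - 1). (\<Sum>x\<in>I. c x * a x m) * monomial_val t m y)"
      by (simp add: sum_distrib_right)
    also have "int p dvd \<dots>" by (intro dvd_sum dvd_mult2 c(2))
    finally have "int p dvd c y * f y y + (\<Sum>x\<in>I - {y}. c x * f x y)"
      using sum.remove[OF finI y, of "\<lambda>x. c x * f x y"] by simp
    moreover have "int p dvd (\<Sum>x\<in>I - {y}. c x * f x y)"
    proof (intro dvd_sum dvd_mult)
      fix x assume x: "x \<in> I - {y}"
      define i where "i = nat (word_inner t x y mod int p)"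
      have p0: "int p > 0" using prime_gt_0_nat[OF p] by simp
      have i: "int i = word_inner t x y mod int p" using p0 by (simp add: i_def)
      have "word_inner t x y mod int p \<noteq> 0" using ndvd[of x y] x y by (auto simp: dvd_eq_mod_eq_0)
      then have "i \<in> {1..p - 1}" using i pos_mod_bound[OF p0, of "word_inner t x y"] by auto
      moreover have "int p dvd word_inner t x y - int i" by (simp add: i dvd_minus_mod)
      ultimately show "int p dvd f x y" unfolding f_def
        by (meson dvd_prodI dvd_trans finite_atLeastAtMost)
    qed
    ultimately have "int p dvd c y * f y y" by (simp add: dvd_add_left_iff)
    moreover have "\<not> int p dvd f y y"
    proof
      assume "int p dvd f y y"
      then obtain i where i: "i \<in> {1..p - 1}" "int p dvd int p - int i"
        using pp by (auto simp: f_def prime_dvd_prod_iff word_inner_self[OF yw(1)])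
      then have "int p dvd int i" by (simp add: dvd_diff_right_iff)
      then have "p dvd i" by (simp only: int_dvd_int_iff)
      then show False using i(1) by (auto dest!: dvd_imp_le)
    qed
    ultimately show ?thesis using pp prime_dvd_mult_iff by blast
  qed
  then show False using c(1) by blast
qed

text \<open>On a common support, two letters have an odd product precisely if they lie on the same
  axis. The number of positions with different axes has the parity of the second-axis letters of
  \<open>x\<close> and \<open>y\<close> together, which is even by \<open>par\<close>; so the inner
  product is congruent to \<open>p\<close> modulo 2.\<close>

lemma word_inner_odd:
  assumes x: "x \<in> words t p" and y: "y \<in> words t p" and p: "odd p" and supp: "word_supp t x = word_supp t y"
    and par: "even (\<Sum>j<t. snd (x j) ^ 2) \<longleftrightarrow> even (\<Sum>j<t. snd (y j) ^ 2)"
  shows "odd (word_inner t x y)"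
proof -
  have "even (\<Sum>j<t. fst (x j) * fst (y j) + snd (x j) * snd (y j)
      + snd (x j) ^ 2 + snd (y j) ^ 2 + (fst (x j) ^ 2 + snd (x j) ^ 2))"
  proof (rule dvd_sum)
    fix j assume j: "j \<in> {..<t}"
    then have "x j \<in> letters" "y j \<in> letters" using x y by (auto simp: words_def)
    moreover have "x j = (0, 0) \<longleftrightarrow> y j = (0, 0)" using supp j by (auto simp: word_supp_def)
    ultimately show "even (fst (x j) * fst (y j) + snd (x j) * snd (y j)
      + snd (x j) ^ 2 + snd (y j) ^ 2 + (fst (x j) ^ 2 + snd (x j) ^ 2))"
      by (auto simp: letters_def)
  qed
  then have "even (word_inner t x y + (\<Sum>j<t. snd (x j) ^ 2) + (\<Sum>j<t. snd (y j) ^ 2) + int p)"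
    unfolding word_norm[OF x, symmetric] word_inner_def sum.distrib by (simp add: add.assoc)
  then show ?thesis using p par unfolding even_add even_of_nat by blast
qed

text \<open>
  Splitting a colour class further by the first nonzero letter separates antipodes, and splitting it by
  the parity of the number of letters \<open>(0, \<plusminus>1)\<close> makes orthogonal words have different supports.
\<close>

lemma monochromatic_orthogonal_words:
  assumes p: "prime p" "odd p" and c: "c ` words t p \<subseteq> {..<k}"
    and large: "8 * k * card (monomials t (p - 1)) < card (words t p)"
  shows "\<exists>x\<in>words t p. \<exists>y\<in>words t p. c x = c y \<and> word_inner t x y = 0 \<and> word_supp t x \<noteq> word_supp t y"
proof (rule ccontr)
  assume none: "\<not> ?thesis"
  define \<kappa> where "\<kappa> x = (c x, x (Min (word_supp t x)), even (\<Sum>j<t. snd (x j) ^ 2))" for x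
  define K where "K = {..<k} \<times> (letters - {(0, 0)}) \<times> (UNIV :: bool set)"
  have first: "Min (word_supp t x) < t \<and> x (Min (word_supp t x)) \<in> letters - {(0, 0)}" if "x \<in> words t p" for x
  proof -
    have "card (word_supp t x) = p" using that by (simp add: words_def)
    then have "word_supp t x \<noteq> {}" using prime_gt_0_nat[OF p(1)] by auto
    then have "Min (word_supp t x) \<in> word_supp t x" by (intro Min_in) (auto simp: word_supp_def)
    then show ?thesis using that by (auto simp: word_supp_def words_def)
  qed
  have sub: "\<kappa> ` words t p \<subseteq> K"
  proof (rule image_subsetI)
    fix x assume x: "x \<in> words t p"
    then have "c x \<in> {..<k}" using c by blast
    then show "\<kappa> x \<in> K" unfolding \<kappa>_def K_def using first[OF x] by (intro SigmaI) auto
  qed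
  \<comment> \<open>The factor 8 in \<open>large\<close>: four nonzero first letters times two
    parities.\<close>
  have cK: "card K = 8 * k" by (simp add: K_def card_cartesian_product card_nonzero_letters)
  have finK: "finite K" by (auto simp: K_def finite_letters)
  have class_le: "card {x\<in>words t p. \<kappa> x = v} \<le> card (monomials t (p - 1))" for v
  proof (rule card_le_monomials[OF p(1)])
    fix x y assume xy: "x \<in> {x\<in>words t p. \<kappa> x = v}" "y \<in> {x\<in>words t p. \<kappa> x = v}" "x \<noteq> y"
    then have w: "x \<in> words t p" "y \<in> words t p" and eq: "c x = c y"
      "x (Min (word_supp t x)) = y (Min (word_supp t y))"
      "even (\<Sum>j<t. snd (x j) ^ 2) \<longleftrightarrow> even (\<Sum>j<t. snd (y j) ^ 2)"
      by (auto simp: \<kappa>_def)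
    show "\<not> int p dvd word_inner t x y"
    proof
      assume "int p dvd word_inner t x y"
      then consider "word_inner t x y = 0" | "\<forall>j<t. y j = (- fst (x j), - snd (x j))"
        using dvd_word_inner_cases[OF w prime_gt_0_nat[OF p(1)]] xy(3) by blast
      then show False
      proof cases
        case 1
        then have "word_supp t x = word_supp t y" using none w eq(1) by blast
        from word_inner_odd[OF w p(2) this eq(3)] show False using 1 by simp
      next
        case 2
        then have "word_supp t y = word_supp t x"
          by (auto simp: word_supp_def prod_eq_iff)
        then have "y (Min (word_supp t y)) = (- fst (x (Min (word_supp t x))), - snd (x (Min (word_supp t x))))" using 2 first[OF w(1)] by simp
        then show False using eq(2) first[OF w(1)] by (auto simp: letters_def)
      qed
    qed
  qed auto
  have "words t p = (\<Union>v\<in>K. {x\<in>words t p. \<kappa> x = v})" using sub by auto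
  then have "card (words t p) \<le> (\<Sum>v\<in>K. card {x\<in>words t p. \<kappa> x = v})"
    using card_UN_le[OF finK, of "\<lambda>v. {x\<in>words t p. \<kappa> x = v}"] by simp
  also have "\<dots> \<le> 8 * k * card (monomials t (p - 1))"
    using sum_bounded_above[of K "\<lambda>v. card {x\<in>words t p. \<kappa> x = v}" "card (monomials t (p - 1))"] class_le cK by simp
  finally show False using large by simp
qed

section \<open>Counting words and monomials\<close>

lemma card_words: "card (words t p) = (t choose p) * 4 ^ p"
proof -
  define S where "S = {A. A \<subseteq> {..<t} \<and> card A = p}"
  have finS: "finite S" by (auto simp: S_def)
  define F where "F A = (\<lambda>f j. if j \<in> A then f j else if j < t then (0, 0) else undefined :: int \<times> int)
    ` (A \<rightarrow>\<^sub>E (letters - {(0, 0)}))" for A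
  have cF: "card (F A) = 4 ^ p \<and> finite (F A)" if "A \<in> S" for A
  proof -
    have A: "A \<subseteq> {..<t}" "card A = p" "finite A" using that by (auto simp: S_def intro: finite_subset)
    have "inj_on (\<lambda>f j. if j \<in> A then f j else if j < t then (0, 0) else undefined :: int \<times> int) (A \<rightarrow>\<^sub>E (letters - {(0, 0)}))"
    proof (rule inj_onI)
      fix f g :: "nat \<Rightarrow> int \<times> int"
      assume fg: "f \<in> A \<rightarrow>\<^sub>E (letters - {(0, 0)})" "g \<in> A \<rightarrow>\<^sub>E (letters - {(0, 0)})"
        and eq: "(\<lambda>j. if j \<in> A then f j else if j < t then (0, 0) else undefined) = (\<lambda>j. if j \<in> A then g j else if j < t then (0, 0) else undefined)"
      show "f = g"
      proof (rule PiE_ext[OF fg])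
        fix j assume "j \<in> A"
        then show "f j = g j" using fun_cong[OF eq, of j] by simp
      qed
    qed
    then have "card (F A) = card (A \<rightarrow>\<^sub>E (letters - {(0, 0)}))" unfolding F_def by (rule card_image)
    also have "\<dots> = 4 ^ p" using A by (simp add: card_PiE card_nonzero_letters)
    finally show ?thesis using A by (auto simp: F_def finite_letters intro!: finite_PiE)
  qed
  have suppF: "word_supp t x = A" if "x \<in> F A" "A \<in> S" for x A
    using that by (auto simp: F_def word_supp_def S_def)
  have "words t p = (\<Union>A\<in>S. F A)"
  proof (intro equalityI subsetI)
    fix x assume x: "x \<in> words t p"
    have "x = (\<lambda>j. if j \<in> word_supp t x then (restrict x (word_supp t x)) j else if j < t then (0, 0) else undefined)"
      using x by (auto simp: fun_eq_iff word_supp_def words_def PiE_def extensional_def)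
    moreover have "restrict x (word_supp t x) \<in> word_supp t x \<rightarrow>\<^sub>E (letters - {(0, 0)})"
      using x by (auto simp: word_supp_def words_def)
    ultimately have "x \<in> F (word_supp t x)" unfolding F_def by blast
    moreover have "word_supp t x \<in> S" using x by (auto simp: S_def words_def word_supp_def)
    ultimately show "x \<in> (\<Union>A\<in>S. F A)" by blast
  next
    fix x assume "x \<in> (\<Union>A\<in>S. F A)"
    then obtain A where A: "A \<in> S" "x \<in> F A" by blast
    then have "card (word_supp t x) = p" using suppF by (auto simp: S_def)
    moreover have "x \<in> {..<t} \<rightarrow>\<^sub>E letters"
    proof -
      obtain f where f: "f \<in> A \<rightarrow>\<^sub>E (letters - {(0, 0)})"
        and x: "x = (\<lambda>j. if j \<in> A then f j else if j < t then (0, 0) else undefined)"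
        using A(2) by (auto simp: F_def)
      have "A \<subseteq> {..<t}" using A(1) by (simp add: S_def)
      moreover have "(0, 0) \<in> letters" by (simp add: letters_def)
      ultimately show ?thesis using f by (auto simp: x PiE_def extensional_def)
    qed
    ultimately show "x \<in> words t p" by (simp add: words_def)
  qed
  also have "card \<dots> = (\<Sum>A\<in>S. card (F A))"
    using finS cF suppF by (intro card_UN_disjoint) blast+
  also have "\<dots> = card S * 4 ^ p" using cF by simp
  also have "card S = t choose p" unfolding S_def using n_subsets[of "{..<t}" p] by simp
  finally show ?thesis .
qed

text \<open>Rankin's trick: since \<open>z \<le> 1\<close>, every admissible monomial has weight at
  least \<open>z ^ r\<close> in the generating function of all monomials, and that function factors
  over the planes.\<close>

lemma card_monomials_le:
  fixes z :: real
  assumes z: "0 < z" "z \<le> 1"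
  shows "card (monomials t r) * z ^ r \<le> (1 + 2 * z + 2 * z\<^sup>2) ^ t"
proof -
  have "card (monomials t r) * z ^ r = (\<Sum>m\<in>monomials t r. z ^ r)" by simp
  also have "\<dots> \<le> (\<Sum>m\<in>monomials t r. \<Prod>j<t. z ^ (fst (m j) + snd (m j)))"
  proof (rule sum_mono)
    fix m assume "m \<in> monomials t r"
    then have "z ^ r \<le> z ^ (\<Sum>j<t. fst (m j) + snd (m j))"
      using z by (intro power_decreasing) (auto simp: monomials_def)
    then show "z ^ r \<le> (\<Prod>j<t. z ^ (fst (m j) + snd (m j)))" by (simp add: power_sum)
  qed
  also have "\<dots> \<le> (\<Sum>m\<in>{..<t} \<rightarrow>\<^sub>E exponents. \<Prod>j<t. z ^ (fst (m j) + snd (m j)))"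
  proof (rule sum_mono2)
    show "finite ({..<t} \<rightarrow>\<^sub>E exponents)" by (intro finite_PiE finite_exponents finite_lessThan)
    show "monomials t r \<subseteq> {..<t} \<rightarrow>\<^sub>E exponents" by (auto simp: monomials_def)
    show "0 \<le> (\<Prod>j<t. z ^ (fst (m j) + snd (m j)))" for m :: "nat \<Rightarrow> nat \<times> nat"
      using z by (intro prod_nonneg) auto
  qed
  also have "\<dots> = (\<Prod>j<t. \<Sum>e\<in>exponents. z ^ (fst e + snd e))"
    by (rule prod_sum_PiE[symmetric]) (auto simp: finite_exponents)
  also have "(\<Sum>e\<in>exponents. z ^ (fst e + snd e)) = 1 + 2 * z + 2 * z\<^sup>2"
    by (simp add: exponents_def power2_eq_square)
  finally show ?thesis by simp
qed

section \<open>Comparison of words and monomials\<close>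

text \<open>The weight \<open>u\<close> is chosen so that the terms
  \<open>(t choose k) * u ^ k\<close> increase up to \<open>k = s\<close> and decrease afterwards;
  the largest of the \<open>t + 1\<close> terms is at least their average.\<close>

lemma binomial_term_max:
  fixes t s :: nat
  assumes s: "0 < s" "s < t"
  defines "u \<equiv> real s / real (t - s)"
  shows "(1 + u) ^ t \<le> (real t + 1) * (real (t choose s) * u ^ s)"
proof -
  define T where "T k = real (t choose k) * u ^ k" for k
  have u: "u > 0" using s by (simp add: u_def)
  have ts: "u * (real t - real s) = real s" "0 < real t - real s" using s by (auto simp: u_def of_nat_diff)
  have step: "real (Suc k) * T (Suc k) = (real t - real k) * u * T k" if "k \<le> t" for k
  proof -
    have "Suc k * (t choose Suc k) = (t - k) * (t choose k)"
      using binomial_absorption[of k t] binomial_absorb_comp[of t k] by simp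
    then have "real (Suc k) * real (t choose Suc k) = (real t - real k) * real (t choose k)"
      using that by (metis of_nat_diff of_nat_mult)
    then show ?thesis by (simp add: T_def mult.assoc[symmetric] mult.commute[of u])
  qed
  have T0: "T k \<ge> 0" for k using u by (simp add: T_def)
  have up: "T k \<le> T (Suc k)" if "k < s" for k
  proof -
    have "real (Suc k) * (real t - real s) \<le> (real t - real k) * real s"
    proof -
      have "(real k + 1) * real t \<le> real s * real t" using that by (intro mult_right_mono) auto
      then show ?thesis by (simp add: algebra_simps)
    qed
    also have "\<dots> = ((real t - real k) * u) * (real t - real s)" using ts by (simp add: mult.assoc)
    finally have "real (Suc k) \<le> (real t - real k) * u" using ts by (simp only: mult_le_cancel_right_pos)
    then have "real (Suc k) * T k \<le> real (Suc k) * T (Suc k)"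
      using T0 step[of k] that s by (metis less_imp_le_nat less_trans mult_right_mono)
    then show ?thesis by (simp del: of_nat_Suc)
  qed
  have down: "T (Suc k) \<le> T k" if "s \<le> k" for k
  proof (cases "k \<le> t")
    case True
    have "(real t - real k) * u * (real t - real s) = (real t - real k) * real s" using ts by (simp add: mult.assoc)
    also have "\<dots> \<le> real (Suc k) * (real t - real s)"
    proof -
      have "real s * real t \<le> real k * real t" using that by (intro mult_right_mono) auto
      then show ?thesis unfolding of_nat_Suc using ts(2) by (simp only: algebra_simps)
    qed
    finally have "(real t - real k) * u \<le> real (Suc k)" using ts by (simp only: mult_le_cancel_right_pos)
    then have "real (Suc k) * T (Suc k) \<le> real (Suc k) * T k"
      using T0 step[OF True] by (metis mult_right_mono)
    then show ?thesis by (simp del: of_nat_Suc)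
  next
    case False
    then have "T (Suc k) = 0" by (simp add: T_def)
    then show ?thesis using T0[of k] by simp
  qed
  have max: "T k \<le> T s" for k
  proof (cases "k \<le> s")
    case True
    then show ?thesis
      by (induction rule: inc_induct) (auto intro: up order_trans)
  next
    case False
    then have "s \<le> k" by simp
    then show ?thesis
      by (induction rule: dec_induct) (auto intro: down order_trans)
  qed
  have "(1 + u) ^ t = (\<Sum>k\<le>t. T k)"
    using binomial_ring[of u 1 t] by (simp add: T_def add.commute)
  also have "\<dots> \<le> (\<Sum>k\<le>t. T s)" by (rule sum_mono) (rule max)
  finally show ?thesis by (simp add: T_def add.commute)
qed

text \<open>
  Both counts are compared through the same \<open>z\<close>; the best density \<open>p / t\<close> would give
  the base \<open>sqrt 5 - 1\<close> in place of 1.159.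
\<close>

lemma words_monomials_ratio:
  assumes p: "prime p" and lo: "31 / 100 * real t \<le> p" and hi: "p \<le> 7 / 10 * real t" and t: "t > 0"
  shows "1.159 ^ t * real (card (monomials t (p - 1))) \<le> (real t + 1) * real (card (words t p))"
proof -
  have pt: "0 < p" "p < t" using prime_gt_0_nat[OF p] lo hi t by auto
  \<comment> \<open>Each of the four nonzero letters gets weight \<open>z\<close>; for this value
    weight \<open>p\<close> gives the dominant term of \<open>(1 + 4 * z) ^ t\<close>.\<close>
  define z where "z = real p / (4 * (real t - real p))"
  have pos: "0 < real t - real p" using pt by simp
  \<comment> \<open>The values of \<open>z\<close> at the extreme densities:
    \<open>0.31 / (4 * 0.69)\<close> and \<open>0.7 / (4 * 0.3)\<close>.\<close>
  have z1: "31 / 276 \<le> z" "z \<le> 7 / 12"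
    using lo hi pos by (simp_all add: z_def field_simps)
  \<comment> \<open>The desired inequality is concave in \<open>z\<close>, so it only has to hold at
    both ends; 1.159 lies just below the ratio at the lower one. The product bounds the square by a
    linear term.\<close>
  have "(z - 31 / 276) * (z - 7 / 12) \<le> 0" using z1 by (intro mult_nonneg_nonpos) auto
  moreover have "(z - a) * (z - b) = z\<^sup>2 - (a + b) * z + a * b" for a b
    by (simp add: power2_eq_square algebra_simps)
  ultimately have "z\<^sup>2 - (31 / 276 + 7 / 12) * z + 31 / 276 * (7 / 12) \<le> 0" by simp
  then have quad: "1.159 * (1 + 2 * z + 2 * z\<^sup>2) \<le> 1 + 4 * z"
    using z1 by simp
  have z: "0 < z" "z \<le> 1" using z1 by auto
  have u: "4 * z = real p / real (t - p)" using pt by (simp add: z_def of_nat_diff field_simps)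
  have "1.159 ^ t * real (card (monomials t (p - 1))) * z ^ p
      \<le> 1.159 ^ t * real (card (monomials t (p - 1))) * z ^ (p - 1)"
    using z by (intro mult_left_mono power_decreasing) auto
  also have "\<dots> \<le> 1.159 ^ t * (1 + 2 * z + 2 * z\<^sup>2) ^ t"
    using card_monomials_le[OF z, of t "p - 1"] by (simp add: mult.assoc)
  also have "\<dots> = (1.159 * (1 + 2 * z + 2 * z\<^sup>2)) ^ t" by (simp only: power_mult_distrib)
  also have "\<dots> \<le> (1 + 4 * z) ^ t" using quad z by (intro power_mono) auto
  also have "\<dots> \<le> (real t + 1) * (real (t choose p) * (4 * z) ^ p)"
    unfolding u by (rule binomial_term_max[OF pt])
  also have "\<dots> = (real t + 1) * real (card (words t p)) * z ^ p"
    by (simp add: card_words power_mult_distrib)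
  finally show ?thesis using z by simp
qed

text \<open>The exponent \<open>2 * t + 1\<close> also covers odd dimensions, where one coordinate
  stays zero. As \<open>1.074 ^ 2 = 1.153476 < 1.159\<close>, there is exponential room for the
  factors \<open>8\<close>, \<open>t + 1\<close> and the additional \<open>1.074\<close>.\<close>

lemma eventually_many_words:
  "\<forall>\<^sub>F t in sequentially. \<exists>p. prime p \<and> odd p \<and> p < t \<and>
     8 * 1.074 ^ (2 * t + 1) * real (card (monomials t (p - 1))) < real (card (words t p))"
proof -
  have "\<forall>\<^sub>F t::nat in sequentially. 8 * ((1153476 / 1000000) ^ t * (1074 / 1000)) * (real t + 1) < (1159 / 1000) ^ t"
    by real_asymp
  moreover have "(1.074::real) ^ (2 * t + 1) = (1153476 / 1000000) ^ t * (1074 / 1000)" for t :: nat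
    by (simp add: power_add power_mult power2_eq_square)
  ultimately have "\<forall>\<^sub>F t::nat in sequentially. 8 * 1.074 ^ (2 * t + 1) * (real t + 1) < 1.159 ^ t"
    by simp
  with eventually_prime_in_range eventually_gt_at_top[of 0] show ?thesis
  proof eventually_elim
    case (elim t)
    then obtain p :: nat where p: "prime p" "odd p" "31 / 100 * real t \<le> p" "p \<le> 7 / 10 * real t" by blast
    have "(\<lambda>j\<in>{..<t}. (0, 0)) \<in> monomials t (p - 1)" by (auto simp: monomials_def exponents_def)
    then have mon: "0 < real (card (monomials t (p - 1)))"
      using finite_monomials by (auto simp: card_gt_0_iff)
    have "(real t + 1) * (8 * 1.074 ^ (2 * t + 1) * real (card (monomials t (p - 1))))
        = (8 * 1.074 ^ (2 * t + 1) * (real t + 1)) * real (card (monomials t (p - 1)))" by (simp only: ac_simps)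
    also have "\<dots> < 1.159 ^ t * real (card (monomials t (p - 1)))"
      using elim mon by (intro mult_strict_right_mono)
    also have "\<dots> \<le> (real t + 1) * real (card (words t p))"
      using p elim by (intro words_monomials_ratio)
    finally have "8 * 1.074 ^ (2 * t + 1) * real (card (monomials t (p - 1))) < real (card (words t p))"
      by (simp add: mult_less_cancel_left)
    moreover have "p < t" using p elim by simp
    ultimately show ?case using p by blast
  qed
qed

section \<open>Greedy sparsification\<close>

text \<open>A cycle of length \<open>l < g\<close> through the new edge uses it only once, so the
  rest of it is a walk of \<open>l - 1\<close> steps in \<open>E\<close> between \<open>a\<close>
  and \<open>b\<close>. Walks rather than paths are excluded because powers of \<open>E\<close> are
  easy to count.\<close>

lemma girth_at_least_insert_edge:
  assumes E: "simple_graph V E" and girth: "girth_at_least g V E"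
    and far: "\<And>n. 1 \<le> n \<Longrightarrow> n < g - 1 \<Longrightarrow> (a, b) \<notin> E ^^ n"
  shows "girth_at_least g V (E \<union> {(a, b), (b, a)})"
  unfolding girth_at_least_def
proof (intro allI impI, rule ccontr)
  fix xs assume cyc: "is_cycle V (E \<union> {(a, b), (b, a)}) xs" and "\<not> g \<le> length xs"
  define l where "l = length xs"
  have l: "3 \<le> l" "l < g" and dist: "distinct xs" and sub: "set xs \<subseteq> V"
    and edge: "\<And>i. i < l \<Longrightarrow> (xs ! i, xs ! ((i + 1) mod l)) \<in> E \<union> {(a, b), (b, a)}"
    using cyc \<open>\<not> g \<le> length xs\<close> by (auto simp: is_cycle_def l_def)
  have symE: "(u, v) \<in> E \<Longrightarrow> (v, u) \<in> E" for u v
    using E by (auto simp: simple_graph_def)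
  have "\<not> is_cycle V E xs"
    using girth l by (auto simp: girth_at_least_def l_def)
  then obtain i where i: "i < l" "(xs ! i, xs ! ((i + 1) mod l)) \<notin> E"
    using l dist sub by (auto simp: is_cycle_def l_def)
  have inj: "xs ! u = xs ! v \<longleftrightarrow> u = v" if "u < l" "v < l" for u v
    using that dist by (simp add: l_def nth_eq_iff_index_eq)
  have step: "(xs ! ((i + 1 + j) mod l), xs ! ((i + 1 + Suc j) mod l)) \<in> E" if j: "j < l - 1" for j
  proof (rule ccontr)
    assume not: "\<not> ?thesis"
    let ?u = "(i + 1 + j) mod l"
    have u: "?u < l" "(?u + 1) mod l < l" "(i + 1) mod l < l" using l by auto
    have eq: "(i + 1 + Suc j) mod l = (?u + 1) mod l" by (simp add: mod_simps)
    have ne: "?u \<noteq> i"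
    proof
      assume "?u = i"
      then have "(i + 1 + j) mod l = i mod l" using i by simp
      then have "(j + 1) mod l = 0"
        using mod_eq_dvd_iff_nat[of i "i+1+j" l] by auto
      then show False using j l by auto
    qed
    have "(xs ! ?u, xs ! ((?u + 1) mod l)) \<in> {(a, b), (b, a)}"
      using edge[OF u(1)] not eq by auto
    moreover have "(xs ! i, xs ! ((i + 1) mod l)) \<in> {(a, b), (b, a)}"
      using edge[OF i(1)] i(2) by auto
    \<comment> \<open>A second use of the new edge repeats a vertex if the direction is the same,
      and forces \<open>l\<close> to divide 2 if it is opposite.\<close>
    ultimately consider "xs ! ?u = xs ! i" | "xs ! ?u = xs ! ((i + 1) mod l)" "xs ! ((?u + 1) mod l) = xs ! i"
      by auto
    then show False
    proof cases
      case 1 then show False using ne inj u i by auto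
    next
      case 2
      then have "?u = (i + 1) mod l" "(?u + 1) mod l = i" using inj u i by auto
      then have "(i + 2) mod l = i mod l" using i by (metis add.assoc mod_add_left_eq mod_less nat_1_add_1)
      then have "l dvd 2" using mod_eq_dvd_iff_nat[of i "i+2" l] by auto
      then show False using l by (auto dest: dvd_imp_le)
    qed
  qed
  have "(xs ! ((i + 1) mod l), xs ! i) \<in> E ^^ (l - 1)"
    unfolding relpow_fun_conv
  proof (intro exI conjI allI impI)
    show "xs ! ((i + 1 + (l - 1)) mod l) = xs ! i" using l i by simp
  qed (use step in auto)
  moreover have "(v, u) \<in> E ^^ n" if "(u, v) \<in> E ^^ n" for u v n
    using that by (induction n arbitrary: v) (simp, metis relpow_Suc_E relpow_Suc_I2 symE)
  ultimately have "(a, b) \<in> E ^^ (l - 1)"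
    using edge[OF i(1)] i(2) by auto
  moreover have "1 \<le> l - 1" "l - 1 < g - 1" using l by linarith+
  ultimately show False using far by blast
qed

lemma card_relpow_le:
  fixes E :: "('a \<times> 'a) set"
  assumes fin: "finite E" and deg: "\<And>x. card (E `` {x}) \<le> D"
  shows "card ((E ^^ n) `` {x}) \<le> D ^ n" and "finite ((E ^^ n) `` {x})"
proof -
  have "card ((E ^^ n) `` {x}) \<le> D ^ n \<and> finite ((E ^^ n) `` {x})"
  proof (induction n)
    case 0
    have "(E ^^ 0) `` {x} = {x}" by auto
    then show ?case by simp
  next
    case (Suc n)
    have eq: "(E ^^ Suc n) `` {x} = (\<Union>y\<in>(E ^^ n) `` {x}. E `` {y})" by auto
    have "card (\<Union>y\<in>(E ^^ n) `` {x}. E `` {y}) \<le> (\<Sum>y\<in>(E ^^ n) `` {x}. card (E `` {y}))"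
      by (rule card_UN_le) (use Suc in auto)
    also have "\<dots> \<le> card ((E ^^ n) `` {x}) * D"
      using sum_bounded_above[of "(E ^^ n) `` {x}" "\<lambda>y. card (E `` {y})" D] deg by auto
    also have "\<dots> \<le> D ^ Suc n" using Suc by simp
    finally have "card (\<Union>y\<in>(E ^^ n) `` {x}. E `` {y}) \<le> D ^ Suc n" .
    moreover have "finite (\<Union>y\<in>(E ^^ n) `` {x}. E `` {y})"
      using Suc finite_Image[OF fin] by auto
    ultimately show ?case unfolding eq by blast
  qed
  then show "card ((E ^^ n) `` {x}) \<le> D ^ n" "finite ((E ^^ n) `` {x})" by auto
qed

text \<open>
  Edges are added one at a time. The candidates that would exceed the degree bound or close a
  short cycle are a small fraction of all candidates, so averaging over the colourings that are
  still proper yields an admissible edge which destroys a fixed proportion of them.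
\<close>

lemma sparse_subgraph_steps:
  fixes X :: "nat set" and Q :: "'q set" and l r :: "'q \<Rightarrow> nat" and \<delta> :: real
  assumes finX: "finite X" and finQ: "finite Q" and Qne: "Q \<noteq> {}"
    and ends: "\<And>q. q \<in> Q \<Longrightarrow> l q \<in> X \<and> r q \<in> X \<and> l q \<noteq> r q"
    and mono: "\<And>c. c \<in> X \<rightarrow>\<^sub>E {..<k} \<Longrightarrow> \<delta> * card Q \<le> card {q\<in>Q. c (l q) = c (r q)}"
    and deg: "\<And>x. x \<in> X \<Longrightarrow> card {q\<in>Q. l q = x \<or> r q = x} \<le> D"
    and mult: "\<And>x y. card {q\<in>Q. l q = x \<and> r q = y} \<le> M"
    and \<delta>: "0 < \<delta>" and \<Delta>: "0 < \<Delta>"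
    and few_saturated: "8 * real L * D \<le> \<Delta> * (\<delta> * card Q)"
    and few_close: "4 * real (card X * (\<Sum>n\<in>{1..<g - 1}. \<Delta> ^ n) * M) \<le> \<delta> * card Q"
    and j: "j \<le> L"
  shows "\<exists>E. simple_graph X E \<and> girth_at_least g X E
           \<and> E \<subseteq> (\<lambda>q. (l q, r q)) ` Q \<union> (\<lambda>q. (r q, l q)) ` Q
           \<and> (\<forall>x. card (E `` {x}) \<le> \<Delta>) \<and> card E \<le> 2 * j
           \<and> real (card {c \<in> X \<rightarrow>\<^sub>E {..<k}. \<forall>(x, y)\<in>E. c x \<noteq> c y}) \<le> real (k ^ card X) * (1 - \<delta> / 2) ^ j"
  using j
proof (induction j)
  case 0
  have "card (X \<rightarrow>\<^sub>E {..<k}) = k ^ card X" using finX by (simp add: card_PiE)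
  moreover have "girth_at_least g X {}"
    unfolding girth_at_least_def is_cycle_def by fastforce
  ultimately show ?case
    by (intro exI[of _ "{}"]) (auto simp: simple_graph_def)
next
  case (Suc j)
  let ?C = "X \<rightarrow>\<^sub>E {..<k}"
  obtain E where E: "simple_graph X E" "girth_at_least g X E"
      "E \<subseteq> (\<lambda>q. (l q, r q)) ` Q \<union> (\<lambda>q. (r q, l q)) ` Q"
      "\<And>x. card (E `` {x}) \<le> \<Delta>" "card E \<le> 2 * j"
      "real (card {c \<in> ?C. \<forall>(x, y)\<in>E. c x \<noteq> c y}) \<le> real (k ^ card X) * (1 - \<delta> / 2) ^ j"
    using Suc by auto
  define alive where "alive = {c \<in> ?C. \<forall>(x, y)\<in>E. c x \<noteq> c y}"
  have finC: "finite ?C" using finX by (intro finite_PiE) auto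
  have fina: "finite alive" using finC by (simp add: alive_def)
  have Esub: "E \<subseteq> X \<times> X" using E(1) by (simp add: simple_graph_def)
  have finE: "finite E" using Esub finX by (meson finite_SigmaI finite_subset)
  have Q0: "0 < real (card Q)" using finQ Qne by (simp add: card_gt_0_iff)
  show ?case
  proof (cases "alive = {}")
    case True
    then have "card {c \<in> ?C. \<forall>(x, y)\<in>E. c x \<noteq> c y} = 0" by (simp only: alive_def card.empty)
    \<comment> \<open>A negative base would need \<open>\<delta> > 2\<close>. One colouring, proper
      or not, gives \<open>\<delta> \<le> 1\<close> by \<open>mono\<close>; if none exists, the
      factor \<open>k ^ card X\<close> is zero.\<close>
    moreover have "0 \<le> real (k ^ card X) * (1 - \<delta> / 2) ^ Suc j"
    proof (cases "?C = {}")
      case True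
      then have "card ?C = 0" by simp
      then have "k ^ card X = 0" using finX by (simp add: card_PiE)
      then show ?thesis by (simp only: of_nat_0 mult_zero_left order_refl)
    next
      case False
      then obtain c where "c \<in> ?C" by blast
      then have "\<delta> * card Q \<le> card {q\<in>Q. c (l q) = c (r q)}" by (rule mono)
      also have "\<dots> \<le> card Q" using card_mono[of Q "{q\<in>Q. c (l q) = c (r q)}"] finQ by auto
      finally have "\<delta> \<le> 1" using Q0 by simp
      then show ?thesis by simp
    qed
    ultimately have "real (card {c \<in> ?C. \<forall>(x, y)\<in>E. c x \<noteq> c y}) \<le> real (k ^ card X) * (1 - \<delta> / 2) ^ Suc j"
      by (simp only: of_nat_0)
    moreover have "card E \<le> 2 * Suc j" using E(5) by simp
    ultimately show ?thesis using E(1-4) by blast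
  next
    case False
    define Sat where "Sat = {x\<in>X. \<Delta> \<le> card (E `` {x})}"
    define F1 where "F1 = {q\<in>Q. l q \<in> Sat \<or> r q \<in> Sat}"
    define P where "P = (\<Union>n\<in>{1..<g-1}. \<Union>x\<in>X. Pair x ` ((E ^^ n) `` {x}))"
    define F2 where "F2 = {q\<in>Q. (l q, r q) \<in> P}"
    have finSat: "finite Sat" using finX by (simp add: Sat_def)
    \<comment> \<open>Degree count: each saturated vertex accounts for \<open>\<Delta>\<close> of
      the at most \<open>2 * L\<close> ordered edges and spoils at most \<open>D\<close>
      candidates.\<close>
    have "card Sat * \<Delta> \<le> (\<Sum>x\<in>Sat. card (E `` {x}))"
      using sum_bounded_below[of Sat \<Delta> "\<lambda>x. card (E `` {x})"] by (auto simp: Sat_def)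
    also have "\<dots> = card (SIGMA x:Sat. E `` {x})"
      using finSat finite_Image[OF finE] by simp
    also have "\<dots> \<le> card E" by (rule card_mono[OF finE]) auto
    finally have cSat: "card Sat * \<Delta> \<le> 2 * L" using E(5) Suc.prems by simp
    have "F1 = (\<Union>x\<in>Sat. {q\<in>Q. l q = x \<or> r q = x})" by (auto simp: F1_def)
    then have "card F1 \<le> (\<Sum>x\<in>Sat. card {q\<in>Q. l q = x \<or> r q = x})"
      using card_UN_le[OF finSat] by simp
    also have "\<dots> \<le> card Sat * D"
      using sum_bounded_above[of Sat "\<lambda>x. card {q\<in>Q. l q = x \<or> r q = x}" D] deg
      by (auto simp: Sat_def)
    finally have "card F1 * \<Delta> \<le> (card Sat * \<Delta>) * D" by (simp add: ac_simps)
    also have "\<dots> \<le> 2 * L * D" using cSat by (rule mult_right_mono) simp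
    finally have "real (card F1 * \<Delta>) \<le> real (2 * L * D)" by linarith
    then have "\<Delta> * (4 * real (card F1)) \<le> \<Delta> * (\<delta> * card Q)"
      using few_saturated by (simp add: mult.commute[of "real \<Delta>" "4 * _"])
    then have F1: "4 * real (card F1) \<le> \<delta> * card Q" using \<Delta> by simp
    have finP: "finite P" unfolding P_def
      using finX card_relpow_le(2)[OF finE E(4)] by blast
    \<comment> \<open>The degree bound limits the walks from each vertex, and every pair they reach
      blocks at most \<open>M\<close> candidates.\<close>
    have "card P \<le> (\<Sum>n\<in>{1..<g-1}. card (\<Union>x\<in>X. Pair x ` ((E ^^ n) `` {x})))"
      unfolding P_def by (rule card_UN_le) simp
    also have "\<dots> \<le> (\<Sum>n\<in>{1..<g-1}. card X * \<Delta> ^ n)"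
    proof (rule sum_mono)
      fix n assume "n \<in> {1..<g-1}"
      have "card (\<Union>x\<in>X. Pair x ` ((E ^^ n) `` {x})) \<le> (\<Sum>x\<in>X. card (Pair x ` ((E ^^ n) `` {x})))"
        by (rule card_UN_le) (rule finX)
      also have "\<dots> \<le> (\<Sum>x\<in>X. \<Delta> ^ n)"
        by (rule sum_mono) (use card_relpow_le[OF finE E(4)] in \<open>simp add: card_image inj_on_def\<close>)
      finally show "card (\<Union>x\<in>X. Pair x ` ((E ^^ n) `` {x})) \<le> card X * \<Delta> ^ n" by simp
    qed
    finally have cP: "card P \<le> card X * (\<Sum>n\<in>{1..<g-1}. \<Delta> ^ n)" by (simp add: sum_distrib_left)
    have "F2 = (\<Union>(x, y)\<in>P. {q\<in>Q. l q = x \<and> r q = y})" by (auto simp: F2_def)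
    then have "card F2 \<le> (\<Sum>z\<in>P. card {q\<in>Q. l q = fst z \<and> r q = snd z})"
      using card_UN_le[OF finP, of "\<lambda>z. {q\<in>Q. l q = fst z \<and> r q = snd z}"] by (simp add: case_prod_beta)
    also have "\<dots> \<le> card P * M"
      using sum_bounded_above[of P "\<lambda>z. card {q\<in>Q. l q = fst z \<and> r q = snd z}" M] mult by auto
    also have "\<dots> \<le> card X * (\<Sum>n\<in>{1..<g-1}. \<Delta> ^ n) * M" using cP by (rule mult_right_mono) simp
    finally have "real (card F2) \<le> real (card X * (\<Sum>n\<in>{1..<g-1}. \<Delta> ^ n) * M)" by linarith
    then have F2: "4 * real (card F2) \<le> \<delta> * card Q" using few_close by linarith
    define R where "R = Q - F1 - F2"
    have finR: "finite R" using finQ by (simp add: R_def)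
    \<comment> \<open>\<open>F1\<close> and \<open>F2\<close> each remove at most a quarter of
      \<open>\<delta> * card Q\<close>, so at least half of this amount remains
      monochromatic.\<close>
    have mono_R: "\<delta> / 2 * card Q \<le> real (card {q\<in>R. c (l q) = c (r q)})" if "c \<in> alive" for c
    proof -
      have "{q\<in>Q. c (l q) = c (r q)} \<subseteq> {q\<in>R. c (l q) = c (r q)} \<union> F1 \<union> F2" by (auto simp: R_def)
      then have "card {q\<in>Q. c (l q) = c (r q)} \<le> card ({q\<in>R. c (l q) = c (r q)} \<union> F1 \<union> F2)"
        using finR finQ by (intro card_mono) (auto simp: F1_def F2_def)
      also have "\<dots> \<le> card {q\<in>R. c (l q) = c (r q)} + card F1 + card F2"
        by (meson add_le_mono1 card_Un_le order_trans)
      finally have "real (card {q\<in>Q. c (l q) = c (r q)}) \<le> card {q\<in>R. c (l q) = c (r q)} + real (card F1) + card F2"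
        by linarith
      moreover have "\<delta> * card Q \<le> card {q\<in>Q. c (l q) = c (r q)}" using that by (intro mono) (simp add: alive_def)
      ultimately show ?thesis using F1 F2 by linarith
    qed
    have "\<exists>q\<in>R. \<delta> / 2 * card alive \<le> card {c\<in>alive. c (l q) = c (r q)}"
    proof (rule ccontr)
      assume "\<not> ?thesis"
      then have less: "\<And>q. q \<in> R \<Longrightarrow> real (card {c\<in>alive. c (l q) = c (r q)}) < \<delta> / 2 * card alive" by force
      obtain c where "c \<in> alive" using False by blast
      from mono_R[OF this] have Rne: "R \<noteq> {}" using \<delta> Q0 by (auto simp: mult_le_0_iff)
      have "card alive * (\<delta> / 2 * card Q) \<le> (\<Sum>c\<in>alive. real (card {q\<in>R. c (l q) = c (r q)}))"
        using sum_bounded_below[of alive "\<delta> / 2 * card Q" "\<lambda>c. real (card {q\<in>R. c (l q) = c (r q)})"] mono_R by auto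
      also have "\<dots> = real (\<Sum>c\<in>alive. \<Sum>q\<in>R. if c (l q) = c (r q) then 1 else 0)"
        using finR by (simp add: sum.If_cases Int_def)
      also have "\<dots> = real (\<Sum>q\<in>R. \<Sum>c\<in>alive. if c (l q) = c (r q) then 1 else 0)"
        by (subst sum.swap) simp
      also have "\<dots> = (\<Sum>q\<in>R. real (card {c\<in>alive. c (l q) = c (r q)}))"
        using fina by (simp add: sum.If_cases Int_def)
      also have "\<dots> < (\<Sum>q\<in>R. \<delta> / 2 * card alive)"
        by (rule sum_strict_mono[OF finR Rne less])
      also have "\<dots> \<le> card Q * (\<delta> / 2 * card alive)"
      proof -
        have "card R \<le> card Q" by (rule card_mono[OF finQ]) (auto simp: R_def)
        then have "real (card R) * (\<delta> / 2 * card alive) \<le> card Q * (\<delta> / 2 * card alive)"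
          using \<delta> by (intro mult_right_mono) auto
        then show ?thesis by simp
      qed
      finally show False by (simp add: ac_simps)
    qed
    then obtain q where q: "q \<in> R" and kill: "\<delta> / 2 * card alive \<le> card {c\<in>alive. c (l q) = c (r q)}" by blast
    have qQ: "q \<in> Q" and qF: "q \<notin> F1" "q \<notin> F2" using q by (auto simp: R_def)
    have e: "l q \<in> X" "r q \<in> X" "l q \<noteq> r q" using ends[OF qQ] by auto
    define E' where "E' = E \<union> {(l q, r q), (r q, l q)}"
    have "simple_graph X E'" using E(1) e by (auto simp: simple_graph_def E'_def)
    moreover have "girth_at_least g X E'" unfolding E'_def
    proof (rule girth_at_least_insert_edge[OF E(1,2)])
      fix n assume "1 \<le> n" "n < g - 1"
      then have "n \<in> {1..<g - 1}" by simp
      then show "(l q, r q) \<notin> E ^^ n" using qF(2) qQ e(1) unfolding F2_def P_def by blast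
    qed
    moreover have "E' \<subseteq> (\<lambda>q. (l q, r q)) ` Q \<union> (\<lambda>q. (r q, l q)) ` Q"
      using E(3) qQ by (auto simp: E'_def)
    moreover have "card (E' `` {x}) \<le> \<Delta>" for x
    proof -
      have E'x: "E' `` {x} = E `` {x} \<union> (if x = l q then {r q} else {}) \<union> (if x = r q then {l q} else {})"
        by (auto simp: E'_def)
      show ?thesis
      proof (cases "x = l q \<or> x = r q")
        case True
        then have "x \<notin> Sat" "x \<in> X" using qF(1) qQ e by (auto simp: F1_def)
        then have lt: "card (E `` {x}) < \<Delta>" by (auto simp: Sat_def)
        obtain y where "E' `` {x} = insert y (E `` {x})" using True e E'x by auto
        then show ?thesis using lt card_insert_le_m1[of \<Delta> "E `` {x}" y] \<Delta> by simp
      next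
        case False
        then show ?thesis using E(4) E'x by auto
      qed
    qed
    moreover have "card E' \<le> 2 * Suc j"
    proof -
      have "card E' \<le> card E + card {(l q, r q), (r q, l q)}" unfolding E'_def by (rule card_Un_le)
      then show ?thesis using E(5) e by auto
    qed
    moreover have "real (card {c \<in> ?C. \<forall>(x, y)\<in>E'. c x \<noteq> c y}) \<le> real (k ^ card X) * (1 - \<delta> / 2) ^ Suc j"
    proof -
      have "{c \<in> ?C. \<forall>(x, y)\<in>E'. c x \<noteq> c y} = alive - {c\<in>alive. c (l q) = c (r q)}"
        by (auto simp: alive_def E'_def)
      then have "real (card {c \<in> ?C. \<forall>(x, y)\<in>E'. c x \<noteq> c y}) = card alive - real (card {c\<in>alive. c (l q) = c (r q)})"
        using fina by (simp add: card_Diff_subset card_mono of_nat_diff)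
      also have "\<dots> \<le> (1 - \<delta> / 2) * card alive" using kill by (simp add: algebra_simps)
      also have "\<dots> \<le> (1 - \<delta> / 2) * (real (k ^ card X) * (1 - \<delta> / 2) ^ j)"
      proof (rule mult_left_mono)
        show "real (card alive) \<le> real (k ^ card X) * (1 - \<delta> / 2) ^ j" using E(6) by (simp add: alive_def)
        have "\<delta> / 2 * card alive \<le> 1 * card alive"
          using kill card_mono[OF fina, of "{c\<in>alive. c (l q) = c (r q)}"] by auto
        then show "0 \<le> 1 - \<delta> / 2" using False fina by (simp add: card_gt_0_iff)
      qed
      finally show ?thesis by (simp add: ac_simps)
    qed
    ultimately show ?thesis by blast
  qed
qed

section \<open>Rotated copies of the words\<close>

text \<open>An infinite supply of angles in \<open>[0, pi / 2)\<close> with distinct cosines,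
  starting with the identity; the cosine alone then identifies the angle.\<close>

definition rot_cos :: "nat \<Rightarrow> real" where
  "rot_cos i = 1 / (real i + 1)"

definition rot_sin :: "nat \<Rightarrow> real" where
  "rot_sin i = sqrt (1 - rot_cos i ^ 2)"

text \<open>Coordinates \<open>2 * j\<close> and \<open>2 * j + 1\<close> form plane
  \<open>j\<close>. There the letter, read as the complex number \<open>a + i b\<close>, is
  multiplied by \<open>c + i s\<close>; \<open>sqrt p\<close> is the norm of the word.\<close>

definition torus_point :: "nat \<Rightarrow> nat \<Rightarrow> (nat \<Rightarrow> int \<times> int) \<Rightarrow> (nat \<Rightarrow> nat) \<Rightarrow> nat \<Rightarrow> real" where
  "torus_point t p x \<theta> n =
     (let j = n div 2; a = of_int (fst (x j)); b = of_int (snd (x j)); c = rot_cos (\<theta> j); s = rot_sin (\<theta> j)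
      in if n < 2 * t then (if even n then a * c - b * s else a * s + b * c) / sqrt p else 0)"

lemma rot_cos_sin: "rot_cos i * rot_cos i + rot_sin i * rot_sin i = 1"
proof -
  have "rot_cos i ^ 2 \<le> 1" unfolding rot_cos_def by (intro power_le_one) auto
  then have "rot_sin i ^ 2 = 1 - rot_cos i ^ 2" by (simp add: rot_sin_def)
  then show ?thesis by (simp add: power2_eq_square)
qed

lemma rot_cos_inj: "rot_cos i = rot_cos j \<longleftrightarrow> i = j"
  by (auto simp: rot_cos_def field_simps)

lemma sum_pairs: "(\<Sum>i<2 * t. f i) = (\<Sum>j<t. f (2 * j) + f (2 * j + 1))" for f :: "nat \<Rightarrow> real"
  by (induction t) (simp_all add: add.assoc)

lemma inner_torus_point:
  assumes "2 * t \<le> d" and "p > 0"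
  shows "inner_d d (torus_point t p x \<theta>) (torus_point t p y \<theta>) = of_int (word_inner t x y) / p"
proof -
  have "inner_d d (torus_point t p x \<theta>) (torus_point t p y \<theta>)
      = (\<Sum>i<2 * t. torus_point t p x \<theta> i * torus_point t p y \<theta> i)"
    unfolding inner_d_def using assms by (intro sum.mono_neutral_right) (auto simp: torus_point_def)
  also have "\<dots> = (\<Sum>j<t. torus_point t p x \<theta> (2 * j) * torus_point t p y \<theta> (2 * j)
      + torus_point t p x \<theta> (2 * j + 1) * torus_point t p y \<theta> (2 * j + 1))"
    by (rule sum_pairs)
  also have "\<dots> = (\<Sum>j<t. of_int (fst (x j) * fst (y j) + snd (x j) * snd (y j)) / p)"
  proof (rule sum.cong)
    fix j assume j: "j \<in> {..<t}"
    define c s where "c = rot_cos (\<theta> j)" and "s = rot_sin (\<theta> j)"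
    have cs: "c * c + s * s = 1" unfolding c_def s_def by (rule rot_cos_sin)
    define a b a' b' where "a = real_of_int (fst (x j))" and "b = real_of_int (snd (x j))"
      and "a' = real_of_int (fst (y j))" and "b' = real_of_int (snd (y j))"
    have "(a * c - b * s) / sqrt p * ((a' * c - b' * s) / sqrt p) + (a * s + b * c) / sqrt p * ((a' * s + b' * c) / sqrt p)
      = ((a * c - b * s) * (a' * c - b' * s) + (a * s + b * c) * (a' * s + b' * c)) / p"
      by (simp only: times_divide_times_eq real_sqrt_mult_self abs_of_nat add_divide_distrib[symmetric])
    also have "(a * c - b * s) * (a' * c - b' * s) + (a * s + b * c) * (a' * s + b' * c) = (a * a' + b * b') * (c * c + s * s)"
      by (simp add: algebra_simps)
    finally show "torus_point t p x \<theta> (2 * j) * torus_point t p y \<theta> (2 * j)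
        + torus_point t p x \<theta> (2 * j + 1) * torus_point t p y \<theta> (2 * j + 1)
        = of_int (fst (x j) * fst (y j) + snd (x j) * snd (y j)) / p"
      using j cs by (simp add: torus_point_def Let_def a_def b_def a'_def b'_def c_def s_def)
  qed simp
  finally show ?thesis by (simp add: word_inner_def sum_divide_distrib)
qed

lemma torus_point_in_sphere:
  assumes "x \<in> words t p" "2 * t \<le> d" "p > 0"
  shows "torus_point t p x \<theta> \<in> unit_sphere d"
  using assms inner_torus_point[of t d p x \<theta> x] word_inner_self[of x t p]
  by (auto simp: unit_sphere_def torus_point_def)

text \<open>Rotations fix the zero letter, so a word has at most one position per choice of angles
  on its support. This keeps the number of vertices small.\<close>

lemma torus_point_restrict: "torus_point t p x (restrict \<theta> (word_supp t x)) = torus_point t p x \<theta>"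
proof
  fix n
  have "x (n div 2) = (0, 0) \<or> n div 2 \<in> word_supp t x" if "n < 2 * t"
    using that by (auto simp: word_supp_def)
  then show "torus_point t p x (restrict \<theta> (word_supp t x)) n = torus_point t p x \<theta> n"
    by (auto simp: torus_point_def Let_def)
qed

text \<open>Whichever axis a nonzero letter lies on, one of its two rotated coordinates is the
  cosine up to sign and scale, and cosines determine the index.\<close>

lemma torus_point_angle:
  assumes x: "x \<in> words t p" and p: "p > 0" and eq: "torus_point t p x \<theta> = torus_point t p x \<theta>'"
    and j: "j \<in> word_supp t x"
  shows "\<theta> j = \<theta>' j"
proof -
  have j': "j < t" "x j \<in> letters - {(0, 0)}" using j x by (auto simp: word_supp_def words_def)
  have "fst (x j) * rot_cos (\<theta> j) - snd (x j) * rot_sin (\<theta> j) = fst (x j) * rot_cos (\<theta>' j) - snd (x j) * rot_sin (\<theta>' j)"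
    using fun_cong[OF eq, of "2 * j"] j'(1) p by (simp add: torus_point_def Let_def)
  moreover have "fst (x j) * rot_sin (\<theta> j) + snd (x j) * rot_cos (\<theta> j) = fst (x j) * rot_sin (\<theta>' j) + snd (x j) * rot_cos (\<theta>' j)"
    using fun_cong[OF eq, of "2 * j + 1"] j'(1) p by (simp add: torus_point_def Let_def)
  ultimately have "rot_cos (\<theta> j) = rot_cos (\<theta>' j)" using j'(2) by (auto simp: letters_def)
  then show ?thesis by (simp add: rot_cos_inj)
qed

lemma card_agreeing_le:
  fixes F :: "(nat \<Rightarrow> nat) set"
  assumes F: "F \<subseteq> {..<t} \<rightarrow>\<^sub>E {..<m}" and A: "A \<subseteq> {..<t}"
    and agree: "\<And>\<theta> \<theta>' j. \<theta> \<in> F \<Longrightarrow> \<theta>' \<in> F \<Longrightarrow> j \<in> A \<Longrightarrow> \<theta> j = \<theta>' j"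
  shows "card F \<le> m ^ (t - card A)"
proof -
  have "inj_on (\<lambda>\<theta>. restrict \<theta> ({..<t} - A)) F"
  proof (rule inj_onI)
    fix \<theta> \<theta>' assume h: "\<theta> \<in> F" "\<theta>' \<in> F" "restrict \<theta> ({..<t} - A) = restrict \<theta>' ({..<t} - A)"
    show "\<theta> = \<theta>'"
    proof (rule PiE_ext)
      show "\<theta> \<in> {..<t} \<rightarrow>\<^sub>E {..<m}" "\<theta>' \<in> {..<t} \<rightarrow>\<^sub>E {..<m}" using h F by auto
      fix j assume "j \<in> {..<t}"
      then show "\<theta> j = \<theta>' j" using agree[OF h(1,2), of j] fun_cong[OF h(3), of j] by (cases "j \<in> A") auto
    qed
  qed
  moreover have "(\<lambda>\<theta>. restrict \<theta> ({..<t} - A)) ` F \<subseteq> ({..<t} - A) \<rightarrow>\<^sub>E {..<m}"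
    using F by (auto simp: PiE_def Pi_def)
  ultimately have "card F \<le> card (({..<t} - A) \<rightarrow>\<^sub>E {..<m})"
    by (intro card_inj_on_le) (auto intro!: finite_PiE)
  also have "\<dots> = m ^ card ({..<t} - A)" by (simp add: card_PiE)
  also have "card ({..<t} - A) = t - card A" using A by (simp add: card_Diff_subset finite_subset)
  finally show ?thesis .
qed

lemma card_pairs_le:
  assumes "finite A" "finite B" and "\<And>a. a \<in> A \<Longrightarrow> card {b\<in>B. P a b} \<le> n"
  shows "card {q\<in>A \<times> B. P (fst q) (snd q)} \<le> card A * n"
proof -
  have "{q\<in>A \<times> B. P (fst q) (snd q)} = (SIGMA a:A. {b\<in>B. P a b})" by auto
  then have "card {q\<in>A \<times> B. P (fst q) (snd q)} = (\<Sum>a\<in>A. card {b\<in>B. P a b})"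
    using assms by simp
  also have "\<dots> \<le> card A * n" using sum_bounded_above[of A "\<lambda>a. card {b\<in>B. P a b}" n] assms by simp
  finally show ?thesis .
qed

text \<open>The constants are fixed in the order \<open>\<delta>\<close>, \<open>C\<close>,
  \<open>\<Delta>\<close>, \<open>m\<close>. Both the girth and the degree bound may influence
  \<open>m\<close>, but \<open>\<Delta>\<close> must not depend on \<open>m\<close>.\<close>

lemma sparse_orthogonality_graph:
  assumes p: "prime p" "odd p" "p < t" and d: "2 * t \<le> d" and k: "0 < k"
    and large: "8 * k * card (monomials t (p - 1)) < card (words t p)"
  shows "\<exists>V E. finite V \<and> simple_graph V E \<and> orthogonality_graph_in d (unit_sphere d) V E \<and>
    girth_at_least g V E \<and> (\<nexists>c. proper_colouring V E c k)"
proof -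
  define H where "H = {(x, y). x \<in> words t p \<and> y \<in> words t p \<and> word_inner t x y = 0 \<and> word_supp t x \<noteq> word_supp t y}"
  define w h where "w = card (words t p)" and "h = card H"
  have p0: "p > 0" using prime_gt_0_nat[OF p(1)] .
  have finH: "finite H" by (rule finite_subset[of _ "words t p \<times> words t p"]) (auto simp: H_def finite_words)
  have mono_H: "\<exists>e\<in>H. c (fst e) = c (snd e)" if "c ` words t p \<subseteq> {..<k}" for c
    using monochromatic_orthogonal_words[OF p(1,2) that large] by (force simp: H_def)
  have "H \<noteq> {}" using mono_H[of "\<lambda>_. 0"] k by auto
  then have h0: "h > 0" using finH by (simp add: h_def card_gt_0_iff)
  \<comment> \<open>Every copy has at least one monochromatic pair among its \<open>h\<close>
    pairs.\<close>
  define \<delta> where "\<delta> = 1 / real h"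
  have \<delta>: "0 < \<delta>" "\<delta> \<le> 1" using h0 by (auto simp: \<delta>_def)
  \<comment> \<open>After \<open>C * card X\<close> steps fewer than one of the
    \<open>k ^ card X\<close> colourings survives.\<close>
  obtain C where C: "(1 - \<delta> / 2) ^ C < 1 / real k"
    using real_arch_pow_inv[of "1 / real k" "1 - \<delta> / 2"] \<delta> k by auto
  \<comment> \<open>There are \<open>C * card X\<close> steps, at most \<open>w * m ^ p\<close>
    vertices and at most \<open>2 * h * m ^ (t - p)\<close> candidates at each; compared with
    \<open>m ^ t\<close>, the powers of \<open>m\<close> cancel.\<close>
  define \<Delta> where "\<Delta> = 16 * C * w * h + 1"
  define S where "S = (\<Sum>n\<in>{1..<g - 1}. \<Delta> ^ n)"
  \<comment> \<open>Here one power of \<open>m\<close> is left over: close pairs block candidates of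
    order \<open>m ^ (t - 1)\<close>, so a large \<open>m\<close> makes them few.\<close>
  define m where "m = 4 * S * w * h + 1"
  define \<Theta> where "\<Theta> = {..<t} \<rightarrow>\<^sub>E {..<m}"
  have fin\<Theta>: "finite \<Theta>" by (auto simp: \<Theta>_def intro!: finite_PiE)
  have c\<Theta>: "card \<Theta> = m ^ t" by (simp add: \<Theta>_def card_PiE)
  let ?P = "torus_point t p"
  \<comment> \<open>The vertices are points, not words with angles, so different copies share
    them.\<close>
  define X0 where "X0 = (\<Union>x\<in>words t p. ?P x ` \<Theta>)"
  have finX0: "finite X0" by (simp add: X0_def finite_words fin\<Theta>)
  obtain \<phi> :: "(nat \<Rightarrow> real) \<Rightarrow> nat" where \<phi>: "inj_on \<phi> X0"
    using finite_imp_inj_to_nat_seg[OF finX0] by blast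
  define X where "X = \<phi> ` X0"
  have finX: "finite X" using finX0 by (simp add: X_def)
  have inX0: "?P x \<theta> \<in> X0" if "x \<in> words t p" "\<theta> \<in> \<Theta>" for x \<theta>
    using that by (auto simp: X0_def)
  have \<phi>_eq: "\<phi> u = \<phi> v \<longleftrightarrow> u = v" if "u \<in> X0" "v \<in> X0" for u v
    using \<phi> that by (auto simp: inj_on_def)
  \<comment> \<open>A candidate is an edge together with its copy. Several copies may place an edge
    at the same two points, hence the multiplicity bound \<open>mult\<close>.\<close>
  define Q where "Q = H \<times> \<Theta>"
  define l where "l q = \<phi> (?P (fst (fst q)) (snd q))" for q :: "((nat \<Rightarrow> int \<times> int) \<times> (nat \<Rightarrow> int \<times> int)) \<times> (nat \<Rightarrow> nat)"
  define r where "r q = \<phi> (?P (snd (fst q)) (snd q))" for q :: "((nat \<Rightarrow> int \<times> int) \<times> (nat \<Rightarrow> int \<times> int)) \<times> (nat \<Rightarrow> nat)"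
  have finQ: "finite Q" using finH fin\<Theta> by (simp add: Q_def)
  have cQ: "\<delta> * real (card Q) = real (m ^ t)"
    using h0 by (simp add: Q_def card_cartesian_product c\<Theta> \<delta>_def h_def)
  have m0: "m > 0" by (simp add: m_def)
  have Qne: "Q \<noteq> {}"
  proof
    assume "Q = {}"
    then show False using cQ m0 by simp
  qed
  have "X0 \<noteq> {}"
  proof -
    obtain q where "q \<in> Q" using Qne by blast
    then show ?thesis using inX0[of "fst (fst q)" "snd q"] by (auto simp: Q_def H_def)
  qed
  then have N0: "card X > 0" using finX by (auto simp: card_gt_0_iff X_def)
  have N: "card X \<le> w * m ^ p"
  proof -
    have "card (?P x ` \<Theta>) \<le> m ^ p" if x: "x \<in> words t p" for x
    proof -
      have sub: "word_supp t x \<subseteq> {..<t}" by (auto simp: word_supp_def)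
      then have fs: "finite (word_supp t x)" by (rule finite_subset) simp
      have "?P x ` \<Theta> \<subseteq> ?P x ` (word_supp t x \<rightarrow>\<^sub>E {..<m})"
      proof (rule image_subsetI)
        fix \<theta> assume "\<theta> \<in> \<Theta>"
        then have "restrict \<theta> (word_supp t x) \<in> word_supp t x \<rightarrow>\<^sub>E {..<m}"
          using sub by (auto simp: \<Theta>_def)
        then show "?P x \<theta> \<in> ?P x ` (word_supp t x \<rightarrow>\<^sub>E {..<m})"
          by (metis image_eqI torus_point_restrict)
      qed
      then have "card (?P x ` \<Theta>) \<le> card (?P x ` (word_supp t x \<rightarrow>\<^sub>E {..<m}))"
        using fs by (intro card_mono finite_imageI finite_PiE) auto
      also have "\<dots> \<le> card (word_supp t x \<rightarrow>\<^sub>E {..<m})"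
        using fs by (intro card_image_le finite_PiE) auto
      also have "\<dots> = m ^ p" using fs x by (simp add: card_PiE words_def)
      finally show ?thesis .
    qed
    then have "card X0 \<le> (\<Sum>x\<in>words t p. m ^ p)"
      unfolding X0_def by (intro order_trans[OF card_UN_le sum_mono] finite_words)
    then show ?thesis using card_image[OF \<phi>] by (simp add: X_def w_def)
  qed
  have fibre: "card {\<theta>\<in>\<Theta>. \<phi> (?P x \<theta>) = v} \<le> m ^ (t - p)" if x: "x \<in> words t p" for x v
  proof -
    have "card {\<theta>\<in>\<Theta>. \<phi> (?P x \<theta>) = v} \<le> m ^ (t - card (word_supp t x))"
    proof (rule card_agreeing_le)
      fix \<theta> \<theta>' j assume h: "\<theta> \<in> {\<theta>\<in>\<Theta>. \<phi> (?P x \<theta>) = v}" "\<theta>' \<in> {\<theta>\<in>\<Theta>. \<phi> (?P x \<theta>) = v}" "j \<in> word_supp t x"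
      then have "?P x \<theta> = ?P x \<theta>'" using \<phi>_eq[OF inX0[OF x] inX0[OF x]] by auto
      then show "\<theta> j = \<theta>' j" using torus_point_angle[OF x p0 _ h(3)] by blast
    qed (auto simp: \<Theta>_def word_supp_def)
    then show ?thesis using x by (simp add: words_def)
  qed
  have edge_fibre: "card {\<theta>\<in>\<Theta>. \<phi> (?P x \<theta>) = u \<and> \<phi> (?P y \<theta>) = v} \<le> m ^ (t - p - 1)" if xy: "(x, y) \<in> H" for x y u v
  proof -
    have x: "x \<in> words t p" and y: "y \<in> words t p" and ne: "word_supp t x \<noteq> word_supp t y"
      using xy by (auto simp: H_def)
    let ?A = "word_supp t x \<union> word_supp t y"
    have finA: "finite ?A" by (simp add: word_supp_def)
    have cx: "card (word_supp t x) = p" and cy: "card (word_supp t y) = p" using x y by (auto simp: words_def)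
    \<comment> \<open>Different supports of equal size are incomparable, so the union fixes at least
      one more angle: the gain of a factor \<open>m\<close> over \<open>fibre\<close>.\<close>
    have "\<not> word_supp t y \<subseteq> word_supp t x"
      using card_subset_eq[of "word_supp t x" "word_supp t y"] finA cx cy ne by auto
    then have "word_supp t x \<subset> ?A" by auto
    then have "p < card ?A" using psubset_card_mono[OF finA] cx by metis
    have "card {\<theta>\<in>\<Theta>. \<phi> (?P x \<theta>) = u \<and> \<phi> (?P y \<theta>) = v} \<le> m ^ (t - card ?A)"
    proof (rule card_agreeing_le)
      fix \<theta> \<theta>' j assume h: "\<theta> \<in> {\<theta>\<in>\<Theta>. \<phi> (?P x \<theta>) = u \<and> \<phi> (?P y \<theta>) = v}"
        "\<theta>' \<in> {\<theta>\<in>\<Theta>. \<phi> (?P x \<theta>) = u \<and> \<phi> (?P y \<theta>) = v}" "j \<in> ?A"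
      then have "?P x \<theta> = ?P x \<theta>'" "?P y \<theta> = ?P y \<theta>'"
        using \<phi>_eq[OF inX0[OF x] inX0[OF x]] \<phi>_eq[OF inX0[OF y] inX0[OF y]] by auto
      then show "\<theta> j = \<theta>' j" using h(3) torus_point_angle[OF x p0] torus_point_angle[OF y p0] by blast
    qed (auto simp: \<Theta>_def word_supp_def)
    also have "\<dots> \<le> m ^ (t - p - 1)" using m0 \<open>p < card ?A\<close> by (intro power_increasing) auto
    finally show ?thesis .
  qed
  have ends: "l q \<in> X \<and> r q \<in> X \<and> l q \<noteq> r q" if q_in: "q \<in> Q" for q
  proof -
    obtain x y \<theta> where q: "q = ((x, y), \<theta>)" "(x, y) \<in> H" "\<theta> \<in> \<Theta>"
      using q_in by (auto simp: Q_def)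
    have xy: "x \<in> words t p" "y \<in> words t p" "word_inner t x y = 0" using q by (auto simp: H_def)
    have "?P x \<theta> \<noteq> ?P y \<theta>"
    proof
      assume "?P x \<theta> = ?P y \<theta>"
      then have "real_of_int (word_inner t x y) / p = real_of_int (word_inner t x x) / p"
        using inner_torus_point[OF d p0, of x \<theta>] by metis
      then show False using xy p0 word_inner_self[OF xy(1)] by simp
    qed
    then show ?thesis using \<phi>_eq xy q inX0 by (auto simp: l_def r_def X_def)
  qed
  have mono: "\<delta> * card Q \<le> card {q\<in>Q. c (l q) = c (r q)}" if c: "c \<in> X \<rightarrow>\<^sub>E {..<k}" for c
  proof -
    have "\<exists>e\<in>H. c (\<phi> (?P (fst e) \<theta>)) = c (\<phi> (?P (snd e) \<theta>))" if "\<theta> \<in> \<Theta>" for \<theta>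
      using c inX0[OF _ that] by (intro mono_H[of "\<lambda>x. c (\<phi> (?P x \<theta>))"]) (auto simp: X_def)
    then obtain e where e: "\<And>\<theta>. \<theta> \<in> \<Theta> \<Longrightarrow> e \<theta> \<in> H \<and> c (\<phi> (?P (fst (e \<theta>)) \<theta>)) = c (\<phi> (?P (snd (e \<theta>)) \<theta>))"
      by metis
    have "card \<Theta> \<le> card {q\<in>Q. c (l q) = c (r q)}"
      using e finQ by (intro card_inj_on_le[of "\<lambda>\<theta>. (e \<theta>, \<theta>)"]) (auto simp: inj_on_def Q_def l_def r_def)
    then show ?thesis unfolding cQ c\<Theta> by (simp only: of_nat_le_iff)
  qed
  have deg: "card {q\<in>Q. l q = v \<or> r q = v} \<le> h * (2 * m ^ (t - p))" for v
    unfolding Q_def l_def r_def h_def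
  proof (rule card_pairs_le[OF finH fin\<Theta>])
    fix e assume "e \<in> H"
    then have e: "fst e \<in> words t p" "snd e \<in> words t p" by (auto simp: H_def)
    have "card {\<theta>\<in>\<Theta>. \<phi> (?P (fst e) \<theta>) = v \<or> \<phi> (?P (snd e) \<theta>) = v}
        = card ({\<theta>\<in>\<Theta>. \<phi> (?P (fst e) \<theta>) = v} \<union> {\<theta>\<in>\<Theta>. \<phi> (?P (snd e) \<theta>) = v})"
      by (rule arg_cong[where f = card]) auto
    also have "\<dots> \<le> card {\<theta>\<in>\<Theta>. \<phi> (?P (fst e) \<theta>) = v} + card {\<theta>\<in>\<Theta>. \<phi> (?P (snd e) \<theta>) = v}"
      by (rule card_Un_le)
    also have "\<dots> \<le> 2 * m ^ (t - p)" using fibre[OF e(1)] fibre[OF e(2)] by (simp add: mult_2 add_mono)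
    finally show "card {\<theta>\<in>\<Theta>. \<phi> (?P (fst e) \<theta>) = v \<or> \<phi> (?P (snd e) \<theta>) = v} \<le> 2 * m ^ (t - p)" .
  qed
  have mult: "card {q\<in>Q. l q = u \<and> r q = v} \<le> h * m ^ (t - p - 1)" for u v
    unfolding Q_def l_def r_def h_def
    by (rule card_pairs_le[OF finH fin\<Theta>]) (use edge_fibre in auto)
  define L where "L = C * card X"
  have "8 * L * (h * (2 * m ^ (t - p))) \<le> 8 * (C * (w * m ^ p)) * (h * (2 * m ^ (t - p)))"
    unfolding L_def by (intro mult_right_mono mult_left_mono N) auto
  also have "\<dots> = (16 * C * w * h) * (m ^ p * m ^ (t - p))" by (simp add: ac_simps)
  also have "m ^ p * m ^ (t - p) = m ^ t" using p by (simp add: power_add[symmetric])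
  also have "(16 * C * w * h) * m ^ t \<le> \<Delta> * m ^ t" by (simp add: \<Delta>_def)
  finally have "real (8 * L * (h * (2 * m ^ (t - p)))) \<le> real (\<Delta> * m ^ t)" by (simp only: of_nat_le_iff)
  then have few_saturated: "8 * real L * real (h * (2 * m ^ (t - p))) \<le> \<Delta> * (\<delta> * card Q)"
    unfolding cQ by simp
  have "4 * (card X * S * (h * m ^ (t - p - 1))) \<le> 4 * (w * m ^ p * S * (h * m ^ (t - p - 1)))"
    by (intro mult_right_mono mult_left_mono N) auto
  also have "\<dots> = (4 * S * w * h) * (m ^ p * m ^ (t - p - 1))" by (simp add: ac_simps)
  also have "m ^ p * m ^ (t - p - 1) = m ^ (t - 1)" using p by (simp add: power_add[symmetric])
  also have "(4 * S * w * h) * m ^ (t - 1) \<le> m * m ^ (t - 1)" by (simp add: m_def)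
  also have "\<dots> = m ^ t" using p by (simp add: power_Suc[symmetric] del: power_Suc)
  finally have "real (4 * (card X * S * (h * m ^ (t - p - 1)))) \<le> real (m ^ t)" by (simp only: of_nat_le_iff)
  then have few_close: "4 * real (card X * (\<Sum>n\<in>{1..<g - 1}. \<Delta> ^ n) * (h * m ^ (t - p - 1))) \<le> \<delta> * card Q"
    unfolding cQ S_def by simp
  have \<Delta>0: "0 < \<Delta>" by (simp add: \<Delta>_def)
  obtain E where E: "simple_graph X E" "girth_at_least g X E"
      "E \<subseteq> (\<lambda>q. (l q, r q)) ` Q \<union> (\<lambda>q. (r q, l q)) ` Q"
      "real (card {c \<in> X \<rightarrow>\<^sub>E {..<k}. \<forall>(x, y)\<in>E. c x \<noteq> c y}) \<le> real (k ^ card X) * (1 - \<delta> / 2) ^ L"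
    using sparse_subgraph_steps[OF finX finQ Qne ends mono deg mult \<delta>(1) \<Delta>0 few_saturated few_close order_refl]
    by blast
  have "real (k ^ card X) * (1 - \<delta> / 2) ^ L = (real k * (1 - \<delta> / 2) ^ C) ^ card X"
    by (simp add: L_def power_mult power_mult_distrib)
  also have "\<dots> < 1"
  proof -
    have "real k * (1 - \<delta> / 2) ^ C < 1" using C k by (simp add: field_simps)
    moreover have "0 \<le> real k * (1 - \<delta> / 2) ^ C" using \<delta> by simp
    ultimately show ?thesis using N0 by (simp add: power_less_one_iff)
  qed
  finally have "card {c \<in> X \<rightarrow>\<^sub>E {..<k}. \<forall>(x, y)\<in>E. c x \<noteq> c y} = 0" using E(4) by linarith
  moreover have "finite {c \<in> X \<rightarrow>\<^sub>E {..<k}. \<forall>(x, y)\<in>E. c x \<noteq> c y}"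
    using finX by (intro finite_subset[OF _ finite_PiE[of X "\<lambda>_. {..<k}"]]) auto
  ultimately have none: "{c \<in> X \<rightarrow>\<^sub>E {..<k}. \<forall>(x, y)\<in>E. c x \<noteq> c y} = {}" by simp
  have "\<nexists>c. proper_colouring X E c k"
  proof
    assume "\<exists>c. proper_colouring X E c k"
    then obtain c where "proper_colouring X E c k" ..
    then have c: "c ` X \<subseteq> {..<k}" "\<And>x y. (x, y) \<in> E \<Longrightarrow> c x \<noteq> c y"
      by (auto simp: proper_colouring_def)
    have "restrict c X \<in> {c \<in> X \<rightarrow>\<^sub>E {..<k}. \<forall>(x, y)\<in>E. c x \<noteq> c y}"
      using c E(1) by (auto simp: simple_graph_def)
    then show False using none by blast
  qed
  moreover have "orthogonality_graph_in d (unit_sphere d) X E"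
    unfolding orthogonality_graph_in_def
  proof (intro exI conjI)
    show "inj_on (inv_into X0 \<phi>) X" unfolding X_def by (rule inj_on_inv_into) simp
    have "inv_into X0 \<phi> ` X = X0" unfolding X_def using \<phi> by (simp add: inv_into_image_cancel)
    also have "\<dots> \<subseteq> unit_sphere d" using torus_point_in_sphere[OF _ d p0] by (auto simp: X0_def)
    finally show "inv_into X0 \<phi> ` X \<subseteq> unit_sphere d" .
    have orth: "inner_d d (inv_into X0 \<phi> (l q)) (inv_into X0 \<phi> (r q)) = 0
        \<and> inner_d d (inv_into X0 \<phi> (r q)) (inv_into X0 \<phi> (l q)) = 0" if q_in: "q \<in> Q" for q
    proof -
      obtain x y \<theta> where q: "q = ((x, y), \<theta>)" "(x, y) \<in> H" "\<theta> \<in> \<Theta>"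
      using q_in by (auto simp: Q_def)
      have xy: "x \<in> words t p" "y \<in> words t p" "word_inner t x y = 0" using q by (auto simp: H_def)
      have "inv_into X0 \<phi> (l q) = ?P x \<theta>" "inv_into X0 \<phi> (r q) = ?P y \<theta>"
        using q \<phi> inX0[OF xy(1) q(3)] inX0[OF xy(2) q(3)] by (auto simp: l_def r_def)
      moreover have "inner_d d (?P x \<theta>) (?P y \<theta>) = 0" using inner_torus_point[OF d p0, of x \<theta> y] xy by simp
      ultimately show ?thesis by (simp add: inner_d_def mult.commute)
    qed
    then show "\<forall>(u, v)\<in>E. inner_d d (inv_into X0 \<phi> u) (inv_into X0 \<phi> v) = 0"
      using E(3) by fast
  qed
  ultimately show ?thesis using finX E(1,2) by blast
qed

section \<open>Chromatic number and conclusion\<close>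

lemma chromatic_number_gt:
  assumes fin: "finite V" and simple: "simple_graph V E" and none: "\<nexists>c. proper_colouring V E c k"
  shows "k < chromatic_number V E"
proof (rule ccontr)
  assume "\<not> ?thesis"
  then have le: "chromatic_number V E \<le> k" by simp
  \<comment> \<open>An injective colouring shows that the \<open>LEAST\<close> is attained.\<close>
  obtain f :: "nat \<Rightarrow> nat" and n where "f ` V = {i. i < n}" "inj_on f V"
    using finite_imp_inj_to_nat_seg[OF fin] by blast
  then have "proper_colouring V E f n"
    using simple unfolding proper_colouring_def simple_graph_def by (auto dest: inj_onD)
  then have "\<exists>c. proper_colouring V E c (chromatic_number V E)"
    using LeastI_ex[of "\<lambda>k. \<exists>c. proper_colouring V E c k"] unfolding chromatic_number_def by blast
  then obtain c where "proper_colouring V E c (chromatic_number V E)" ..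
  then have "proper_colouring V E c k" using le unfolding proper_colouring_def by fastforce
  then show False using none by blast
qed

theorem theorem1p3:
  shows "\<exists>\<epsilon> :: nat \<Rightarrow> real. \<epsilon> \<longlonglongrightarrow> 0 \<and>
    (\<forall>g d :: nat. g \<ge> 3 \<longrightarrow> d > 0 \<longrightarrow>
      (\<exists>V E. finite V \<and> simple_graph V E \<and>
         orthogonality_graph_in d (unit_sphere d) V E \<and>
         girth_at_least g V E \<and>
         real (chromatic_number V E) \<ge> (1.074 + \<epsilon> d) ^ d))"
proof -
  obtain t0 where t0: "\<And>t. t0 \<le> t \<Longrightarrow> \<exists>p. prime p \<and> odd p \<and> p < t \<and>
     8 * 1.074 ^ (2 * t + 1) * real (card (monomials t (p - 1))) < real (card (words t p))"
    using eventually_many_words by (auto simp: eventually_sequentially)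
  \<comment> \<open>Below the threshold the base becomes 1, and a single vertex suffices.\<close>
  define \<epsilon> :: "nat \<Rightarrow> real" where "\<epsilon> d = (if d < 2 * t0 then - 0.074 else 0)" for d
  have "\<forall>\<^sub>F d in sequentially. \<epsilon> d = 0"
    using eventually_ge_at_top[of "2 * t0"] by eventually_elim (simp add: \<epsilon>_def)
  then have "\<epsilon> \<longlonglongrightarrow> 0" by (rule tendsto_eventually)
  moreover have "\<exists>V E. finite V \<and> simple_graph V E \<and> orthogonality_graph_in d (unit_sphere d) V E \<and>
      girth_at_least g V E \<and> real (chromatic_number V E) \<ge> (1.074 + \<epsilon> d) ^ d" if d: "d > 0" for g d :: nat
  proof (cases "d < 2 * t0")
    case True
    have "(\<lambda>i. if i = 0 then 1 else 0) \<in> unit_sphere d"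
      using d by (auto simp: unit_sphere_def inner_d_def if_distrib[of "\<lambda>u. u * _"] cong: if_cong)
    then have "orthogonality_graph_in d (unit_sphere d) {0} {}"
      unfolding orthogonality_graph_in_def by (intro exI[of _ "\<lambda>_ i. if i = 0 then 1 else 0"]) auto
    moreover have "simple_graph {0} {}" by (simp add: simple_graph_def)
    moreover have "girth_at_least g {0} {}" unfolding girth_at_least_def is_cycle_def by fastforce
    moreover have "0 < chromatic_number {0} {}"
      by (rule chromatic_number_gt) (auto simp: simple_graph_def proper_colouring_def)
    ultimately show ?thesis using True by (intro exI[of _ "{0}"] exI[of _ "{}"]) (simp add: \<epsilon>_def)
  next
    case False
    define t where "t = d div 2"
    have t: "t0 \<le> t" "2 * t \<le> d" "d \<le> 2 * t + 1" using False by (auto simp: t_def)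
    obtain p where p: "prime p" "odd p" "p < t"
      "8 * 1.074 ^ (2 * t + 1) * real (card (monomials t (p - 1))) < real (card (words t p))"
      using t0[OF t(1)] by blast
    \<comment> \<open>The strict bound \<open>k < chromatic_number V E\<close> recovers what
      rounding down loses.\<close>
    define k where "k = nat \<lfloor>(1.074::real) ^ d\<rfloor>"
    have one: "(1::real) \<le> 1.074 ^ d" by (rule one_le_power) simp
    have k: "0 < k" "real k \<le> 1.074 ^ d" "1.074 ^ d < real k + 1"
      using one unfolding k_def by linarith+
    have "real (8 * k * card (monomials t (p - 1))) \<le> 8 * 1.074 ^ (2 * t + 1) * real (card (monomials t (p - 1)))"
    proof -
      have "real k \<le> 1.074 ^ (2 * t + 1)"
        using k(2) power_increasing[OF t(3), of "1.074::real"] by simp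
      then have "8 * real k * real (card (monomials t (p - 1))) \<le> 8 * 1.074 ^ (2 * t + 1) * real (card (monomials t (p - 1)))"
        by (intro mult_right_mono mult_left_mono) auto
      then show ?thesis by (simp only: of_nat_mult of_nat_numeral)
    qed
    then have "real (8 * k * card (monomials t (p - 1))) < real (card (words t p))" using p(4) by linarith
    then have "8 * k * card (monomials t (p - 1)) < card (words t p)" by (simp only: of_nat_less_iff)
    from sparse_orthogonality_graph[OF p(1-3) t(2) k(1) this, of g] obtain V E where
      VE: "finite V" "simple_graph V E" "orthogonality_graph_in d (unit_sphere d) V E" "girth_at_least g V E"
        "\<nexists>c. proper_colouring V E c k" by blast
    have "k < chromatic_number V E" by (rule chromatic_number_gt[OF VE(1,2,5)])
    then have "(1.074 + \<epsilon> d) ^ d \<le> real (chromatic_number V E)" using False k(3) by (simp add: \<epsilon>_def)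
    then show ?thesis using VE by blast
  qed
  ultimately show ?thesis by blast
qed

end
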